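(* Let $(c_n)_{n\in\mathbb N}$ be a sequence of non-negative real numbers with $\sum_{n\in\mathbb N}c_n=1$, let $(\vartheta_n)_{n\in\mathbb N}$ be independent random variables, each uniformly distributed on $[0,2\pi)$, and put $\zeta_n=e^{i\vartheta_n}$. Let $\mu=\sum_{n\in\mathbb N}c_n\delta_{\zeta_n}$ and let $\varphi$ be the associated random inner function $$\varphi(z)=\frac{H\mu(z)-1}{H\mu(z)+1},\qquad H\mu(z)=\int_{\mathbb T}\frac{\zeta+z}{\zeta-z}\,d\mu(\zeta),\qquad z\in\mathbb D.$$ Then $\varphi$ is almost surely a Blaschke product.
   Context: $\mathbb D$ is the open unit disk in $\mathbb C$, $\mathbb T=\partial\mathbb D$. An inner function is an analytic map $\varphi:\mathbb D\to\mathbb D$ whose radial limits have modulus $1$ at Lebesgue-almost every point of $\mathbb T$. The random function $\varphi$ in the claim is inner (equivalently, $\mu$ is its Clark measure at $1$, which is singular with respect to Lebesgue measure). A Blaschke product is a function of the form $$B(z)=e^{ic}z^m\prod_{z_n\neq 0}\frac{|z_n|}{z_n}\,\frac{z_n-z}{1-\overline{z_n}z},$$ with $c\in\mathbb R$, $m\ge 0$ an integer, and $(z_n)$ a finite or infinite sequence in $\mathbb D$ with $\sum_n(1-|z_n|)<\infty$. *)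

theory Defs
  imports "HOL-Probability.Probability" "HOL-Library.Extended_Nat"
begin

abbreviation circle_algebra :: "complex measure" where
  "circle_algebra \<equiv> restrict_space borel (sphere 0 1)"

definition atomic_measure :: "(nat \<Rightarrow> real) \<Rightarrow> (nat \<Rightarrow> complex) \<Rightarrow> complex measure" where
  "atomic_measure c \<zeta> = measure_of (sphere 0 1) (sets circle_algebra)
     (\<lambda>A. \<Sum>n. ennreal (c n) * emeasure (return circle_algebra (\<zeta> n)) A)"

lemma space_atomic_measure [simp]: "space (atomic_measure c \<zeta>) = sphere 0 1"
  unfolding atomic_measure_def
  using sets.space_closed[of circle_algebra]
  by (intro space_measure_of) (simp add: space_restrict_space)

lemma sets_atomic_measure [simp, measurable_cong]:
  "sets (atomic_measure c \<zeta>) = sets circle_algebra"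
  unfolding atomic_measure_def
  using sets.sigma_sets_eq[of circle_algebra] sets.space_closed[of circle_algebra]
  by (subst sets_measure_of) (auto simp: space_restrict_space)

text \<open>The constructor \<^const>\<open>measure_of\<close> yields the zero measure if its argument is not
  countably additive; the following lemma excludes this degeneration.\<close>

lemma emeasure_atomic_measure:
  assumes A: "A \<in> sets circle_algebra"
  shows "emeasure (atomic_measure c \<zeta>) A = (\<Sum>n. ennreal (c n) * indicator A (\<zeta> n))"
proof -
  let ?\<mu> = "\<lambda>A. \<Sum>n. ennreal (c n) * emeasure (return circle_algebra (\<zeta> n)) A"
  have "countably_additive (sets circle_algebra) ?\<mu>"
  proof (rule countably_additiveI)
    fix F :: "nat \<Rightarrow> complex set"
    assume F: "range F \<subseteq> sets circle_algebra" "disjoint_family F"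
    have "(\<Sum>i. ?\<mu> (F i)) =
        (\<Sum>i. \<integral>\<^sup>+n. ennreal (c n) * emeasure (return circle_algebra (\<zeta> n)) (F i) \<partial>count_space UNIV)"
      by (simp add: nn_integral_count_space_nat)
    also have "\<dots> = (\<integral>\<^sup>+n. (\<Sum>i. ennreal (c n) * emeasure (return circle_algebra (\<zeta> n)) (F i)) \<partial>count_space UNIV)"
      by (subst nn_integral_suminf) auto
    also have "\<dots> = (\<Sum>n. \<Sum>i. ennreal (c n) * emeasure (return circle_algebra (\<zeta> n)) (F i))"
      by (simp add: nn_integral_count_space_nat)
    also have "\<dots> = ?\<mu> (\<Union>i. F i)"
      using F by (simp only: ennreal_suminf_cmult sets_return suminf_emeasure)
    finally show "(\<Sum>i. ?\<mu> (F i)) = ?\<mu> (\<Union>i. F i)" .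
  qed
  then have "emeasure (atomic_measure c \<zeta>) A = ?\<mu> A"
    using A sets.space_closed[of circle_algebra]
    by (intro emeasure_measure_of[OF atomic_measure_def])
      (simp_all add: positive_def space_restrict_space)
  with A show ?thesis
    by simp
qed

definition herglotz :: "complex measure \<Rightarrow> complex \<Rightarrow> complex" where
  "herglotz \<mu> z = (\<integral>\<zeta>. (\<zeta> + z) / (\<zeta> - z) \<partial>\<mu>)"

definition associated_inner :: "complex measure \<Rightarrow> complex \<Rightarrow> complex" where
  "associated_inner \<mu> z = (herglotz \<mu> z - 1) / (herglotz \<mu> z + 1)"

definition blaschke_factor :: "complex \<Rightarrow> complex \<Rightarrow> complex" where
  "blaschke_factor a z = (of_real (cmod a) / a) * ((a - z) / (1 - cnj a * z))"

text \<open>The extended natural number \<open>N\<close> is the length of the finite or infinite sequence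
  \<open>a\<close>; values of \<open>a\<close> beyond that length are irrelevant.\<close>

definition blaschke :: "real \<Rightarrow> nat \<Rightarrow> enat \<Rightarrow> (nat \<Rightarrow> complex) \<Rightarrow> complex \<Rightarrow> complex" where
  "blaschke c m N a z = exp (\<i> * of_real c) * z ^ m *
     (\<Prod>n. if enat n < N \<and> a n \<noteq> 0 then blaschke_factor (a n) z else 1)"

text \<open>Only the values of \<open>f\<close> on the open unit disk matter.\<close>

definition is_blaschke_product :: "(complex \<Rightarrow> complex) \<Rightarrow> bool" where
  "is_blaschke_product f \<longleftrightarrow>
     (\<exists>c m N a. (\<forall>n. enat n < N \<longrightarrow> a n \<in> ball 0 1) \<and>
        summable (\<lambda>n. if enat n < N then 1 - cmod (a n) else 0) \<and>
        (\<forall>z\<in>ball 0 1. f z = blaschke c m N a z))"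

lemma norm_blaschke_factor_minus_1:
  assumes "a \<noteq> 0" "cmod a < 1" "cmod z < 1"
  shows "cmod (blaschke_factor a z - 1) \<le> 2 / (1 - cmod z) * (1 - cmod a)"
proof -
  define r where "r = cmod a"
  have r: "0 < r" "r < 1" using assms by (auto simp: r_def)
  have aa: "a * cnj a = of_real r * of_real r"
    by (simp add: r_def complex_norm_square[symmetric] power2_eq_square[symmetric])
  have "cmod (cnj a * z) \<le> cmod z"
    using assms by (simp add: norm_mult mult_left_le_one_le)
  then have d: "1 - cmod z \<le> cmod (1 - cnj a * z)"
    using norm_triangle_ineq2[of 1 "cnj a * z"] by simp
  then have nz: "1 - cnj a * z \<noteq> 0" using assms by auto
  have "blaschke_factor a z * (a * (1 - cnj a * z)) = of_real r * (a - z)"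
    using nz assms(1) by (simp add: blaschke_factor_def r_def[symmetric])
  then have "a * (blaschke_factor a z - 1) * (1 - cnj a * z) = of_real r * (a - z) - a * (1 - cnj a * z)"
    by (simp add: algebra_simps)
  also have "\<dots> = of_real (r - 1) * (a + of_real r * z)"
    using aa by (simp add: algebra_simps)
  finally have "r * cmod (blaschke_factor a z - 1) * cmod (1 - cnj a * z) = (1 - r) * cmod (a + of_real r * z)"
    using r by (metis norm_mult norm_of_real r_def abs_minus_commute abs_of_pos diff_gt_0_iff_gt)
  also have "\<dots> \<le> (1 - r) * (r * 2)"
  proof -
    have "cmod (a + of_real r * z) \<le> r + r * cmod z"
      using r by (metis norm_triangle_ineq norm_mult norm_of_real r_def abs_of_pos)
    also have "\<dots> \<le> r * 2" using r assms by (simp add: mult_left_le)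
    finally show ?thesis using r by (intro mult_left_mono) auto
  qed
  finally have "cmod (blaschke_factor a z - 1) * cmod (1 - cnj a * z) \<le> 2 * (1 - r)"
    using r by (simp add: mult.assoc mult.left_commute[of _ r])
  moreover have "cmod (blaschke_factor a z - 1) * (1 - cmod z) \<le> cmod (blaschke_factor a z - 1) * cmod (1 - cnj a * z)"
    using d by (intro mult_left_mono) auto
  ultimately show ?thesis
    using assms by (simp add: r_def field_simps)
qed

text \<open>Under the Blaschke condition the infinite product in \<^const>\<open>blaschke\<close> is a genuine
  (convergent) one.\<close>

lemma convergent_prod_blaschke:
  assumes "\<forall>n. enat n < N \<longrightarrow> a n \<in> ball 0 1"
    and "summable (\<lambda>n. if enat n < N then 1 - cmod (a n) else 0)"
    and "z \<in> ball 0 1"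
  shows "convergent_prod (\<lambda>n. if enat n < N \<and> a n \<noteq> 0 then blaschke_factor (a n) z else 1)"
proof (rule abs_convergent_prod_imp_convergent_prod, rule summable_imp_abs_convergent_prod,
    rule summable_comparison_test')
  show "summable (\<lambda>n. 2 / (1 - cmod z) * (if enat n < N then 1 - cmod (a n) else 0))"
    using assms(2) by (rule summable_mult)
next
  fix n :: nat
  show "norm (norm ((if enat n < N \<and> a n \<noteq> 0 then blaschke_factor (a n) z else 1) - 1))
      \<le> 2 / (1 - cmod z) * (if enat n < N then 1 - cmod (a n) else 0)"
    using norm_blaschke_factor_minus_1[of "a n" z] assms by auto
qed

end

theory Submission
  imports Defs "HOL-Complex_Analysis.Complex_Analysis"
begin

text \<open>
  Let \<open>f\<close> be holomorphic on the disk with \<open>|f| \<le> 1\<close>. Dividing \<open>f\<close> by the Blaschke product of its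
  zeros leaves a zero-free function \<open>g\<close> with \<open>|f| \<le> |g| \<le> 1\<close>, and by the mean value property
  \<open>- log |g(0)|\<close> is at most the circle mean of \<open>- log |f|\<close>, for every radius. Hence if these means get
  arbitrarily small, then \<open>|g(0)| = 1\<close>, so \<open>g\<close> is a unimodular constant and \<open>f\<close> is a Blaschke
  product. This is \<open>is_blaschke_product_if_small_log_means\<close>. Its proof strips off one zero at a time, always
  one of minimal modulus: the quotients are then zero-free on disks that grow to the unit disk.

  It remains to find radii \<open>r\<close> tending to 1 along which the circle mean of \<open>- log |\<phi>|\<close> has
  expectation tending to 0; Fatou's lemma then provides, almost surely, arbitrarily small circle
  means. By Tonelli's theorem the expectation of \<open>- log |\<phi>(z)|\<close> may be
  estimated for each fixed \<open>z\<close> with \<open>|z| = r\<close>. Fix one index \<open>k\<close> with \<open>c = c\<^sub>k > 0\<close> and condition on the other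
  atoms, that is, write \<open>H\<mu>(z) = c (\<zeta> + z) / (\<zeta> - z) + y\<close>, where \<open>\<zeta>\<close> is uniform on the circle and
  independent of \<open>y\<close>, and \<open>Re y \<ge> 0\<close>. Then \<open>|\<phi>(z)|\<close> is a quotient of moduli of two expressions that are linear
  in \<open>\<zeta>\<close>, and Jensen's formula for linear functions, under which \<open>log |\<alpha> + \<beta> \<zeta>|\<close> has mean \<open>log max(|\<alpha>|, |\<beta>|)\<close>,
  computes the conditional expectation as
  \<open>log |c + y + 1| - log max(r |c + 1 - y|, |c + y - 1|)\<close>. Since the maximum is at least
  \<open>r c\<close>, this logarithm has no singularity, and it is at most
  \<open>- log r + (4 / c\<^sup>2) min(1, Re y)\<close> (\<open>mean_neg_log_one_atom\<close>): averaging over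
  a single atom supplies the uniform integrability of \<open>log |\<phi>|\<close> that can fail for an inner function, for
  instance for a singular one.

  Finally \<open>Re y\<close> is the Poisson integral of a purely atomic measure, so that the circle
  means of \<open>min(1, Re y)\<close> tend to 0 for every position of the atoms, as one sees by treating each
  atom separately (\<open>mean_min_1_Re_herglotz_sum_tendsto_0\<close>).
\<close>

section \<open>Means over circles\<close>

abbreviation uniform_angle :: "real measure" where
  "uniform_angle \<equiv> uniform_measure lborel {0..<2 * pi}"

lemma prob_space_uniform_angle: "prob_space uniform_angle"
  by (rule prob_space_uniform_measure) (simp_all add: emeasure_lborel_Ico)

lemma uniform_angle_eq_density:
  "uniform_angle = density lborel (\<lambda>t. ennreal (indicator {0..<2 * pi} t / (2 * pi)))"
proof -
  have "indicator {0..<2 * pi} t / emeasure lborel {0..<2 * pi}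
      = ennreal (indicator {0..<2 * pi} t / (2 * pi))" for t :: real
    using divide_ennreal[of 1 "2 * pi"] by (simp add: indicator_def emeasure_lborel_Ico)
  then show ?thesis
    by (simp add: uniform_measure_def)
qed

lemma cis_measurable [measurable]: "cis \<in> borel_measurable borel"
  by (intro borel_measurable_continuous_onI continuous_intros)

lemma continuous_uniform_angle_integral:
  fixes f :: "real \<Rightarrow> 'b::euclidean_space"
  assumes cont: "continuous_on {0..2 * pi} f" and meas: "f \<in> borel_measurable borel"
  shows "integrable uniform_angle f"
    and "(\<integral>t. f t \<partial>uniform_angle) = integral {0..2 * pi} f /\<^sub>R (2 * pi)"
proof -
  note [measurable] = meas
  have int: "integrable lborel (\<lambda>t. indicator {0..2 * pi} t *\<^sub>R f t)"
    using borel_integrable_atLeastAtMost'[OF cont] by (simp add: set_integrable_def)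
  have ae: "AE t in lborel. (indicator {0..<2 * pi} t / (2 * pi)) *\<^sub>R f t
      = (indicator {0..2 * pi} t *\<^sub>R f t) /\<^sub>R (2 * pi)"
    using AE_lborel_singleton[of "2 * pi"]
    by eventually_elim (auto simp: indicator_def inverse_eq_divide)
  have "integrable lborel (\<lambda>t. (indicator {0..2 * pi} t *\<^sub>R f t) /\<^sub>R (2 * pi))"
    by (rule integrable_scaleR_right[OF int])
  then have "integrable lborel (\<lambda>t. (indicator {0..<2 * pi} t / (2 * pi)) *\<^sub>R f t)"
    by (subst integrable_cong_AE[OF _ _ ae]) measurable
  then show "integrable uniform_angle f"
    unfolding uniform_angle_eq_density by (subst integrable_density) auto
  have "(\<integral>t. f t \<partial>uniform_angle) = (\<integral>t. (indicator {0..<2 * pi} t / (2 * pi)) *\<^sub>R f t \<partial>lborel)"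
    unfolding uniform_angle_eq_density by (subst integral_density) auto
  also have "\<dots> = (\<integral>t. (indicator {0..2 * pi} t *\<^sub>R f t) /\<^sub>R (2 * pi) \<partial>lborel)"
    by (rule integral_cong_AE[OF _ _ ae]) measurable
  also have "\<dots> = integral {0..2 * pi} f /\<^sub>R (2 * pi)"
    using set_borel_integral_eq_integral(2)[OF borel_integrable_atLeastAtMost'[OF cont]]
    by (simp only: set_lebesgue_integral_def integral_scaleR_right)
  finally show "(\<integral>t. f t \<partial>uniform_angle) = integral {0..2 * pi} f /\<^sub>R (2 * pi)" .
qed

lemma mean_value_circle:
  assumes hol: "h holomorphic_on ball 0 R" and r: "0 < r" "r < R"
  shows "integrable uniform_angle (\<lambda>t. h (of_real r * cis t))"
    and "(\<integral>t. h (of_real r * cis t) \<partial>uniform_angle) = h 0"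
proof -
  have circ: "of_real r * cis t \<in> ball 0 R" for t
    using r by (simp add: norm_mult)
  have "continuous_on UNIV (\<lambda>t. h (of_real r * cis t))"
    by (rule continuous_on_compose2[OF holomorphic_on_imp_continuous_on[OF hol]])
      (use circ in \<open>auto intro!: continuous_intros\<close>)
  then have cont: "continuous_on S (\<lambda>t. h (of_real r * cis t))" for S
    by (rule continuous_on_subset) simp
  have meas: "(\<lambda>t. h (of_real r * cis t)) \<in> borel_measurable borel"
    by (intro borel_measurable_continuous_onI cont)
  show "integrable uniform_angle (\<lambda>t. h (of_real r * cis t))"
    by (rule continuous_uniform_angle_integral(1)[OF cont meas])
  have "((\<lambda>u. h u / (u - 0)) has_contour_integral (2 * of_real pi * \<i> * h 0)) (circlepath 0 r)"
    using r by (intro Cauchy_integral_circlepath_simple holomorphic_on_subset[OF hol]) auto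
  then have "((\<lambda>t. h (0 + r * cis t) / (0 + r * cis t - 0) * r * \<i> * cis t)
      has_integral (2 * of_real pi * \<i> * h 0)) {0..2 * pi}"
    unfolding circlepath_def by (subst (asm) has_contour_integral_part_circlepath_iff) auto
  moreover have "h (0 + r * cis t) / (0 + r * cis t - 0) * r * \<i> * cis t = h (r * cis t) * \<i>" for t
    using r by simp
  ultimately have "((\<lambda>t. h (r * cis t) * \<i>) has_integral (2 * of_real pi * \<i> * h 0)) {0..2 * pi}"
    by (simp only:)
  then have "((\<lambda>t. h (r * cis t) * \<i> * (-\<i>)) has_integral (2 * of_real pi * \<i> * h 0 * (-\<i>))) {0..2 * pi}"
    by (rule has_integral_mult_left)
  moreover have "2 * of_real pi * \<i> * h 0 * (-\<i>) = 2 * of_real pi * h 0"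
    "\<And>t. h (r * cis t) * \<i> * (-\<i>) = h (r * cis t)"
    by (simp_all add: mult.assoc mult.left_commute)
  ultimately have "((\<lambda>t. h (r * cis t)) has_integral (2 * of_real pi * h 0)) {0..2 * pi}"
    by (simp only:)
  then show "(\<integral>t. h (of_real r * cis t) \<partial>uniform_angle) = h 0"
    unfolding continuous_uniform_angle_integral(2)[OF cont meas] 
    by (subst integral_unique, assumption) (simp add: scaleR_conv_of_real)
qed

text \<open>
  A zero-free function on a disk has a holomorphic logarithm, whose real part is \<open>ln |g|\<close>.
\<close>

lemma mean_value_ln_norm:
  assumes hol: "g holomorphic_on ball 0 R" and nz: "\<And>z. z \<in> ball 0 R \<Longrightarrow> g z \<noteq> 0"
    and r: "0 < r" "r < R"
  shows "integrable uniform_angle (\<lambda>t. ln (cmod (g (of_real r * cis t))))"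
    and "(\<integral>t. ln (cmod (g (of_real r * cis t))) \<partial>uniform_angle) = ln (cmod (g 0))"
proof -
  obtain h where h: "h holomorphic_on ball 0 R" "\<And>z. z \<in> ball 0 R \<Longrightarrow> g z = exp (h z)"
    using contractible_imp_holomorphic_log[OF hol convex_imp_contractible[OF convex_ball] nz] by blast
  have ln: "ln (cmod (g z)) = Re (h z)" if "z \<in> ball 0 R" for z
    using h(2)[OF that] by simp
  have circ: "of_real r * cis t \<in> ball 0 R" for t
    using r by (simp add: norm_mult)
  note mv = mean_value_circle[OF h(1) r]
  show "integrable uniform_angle (\<lambda>t. ln (cmod (g (of_real r * cis t))))"
    using integrable_Re[OF mv(1)] by (simp only: ln[OF circ])
  show "(\<integral>t. ln (cmod (g (of_real r * cis t))) \<partial>uniform_angle) = ln (cmod (g 0))"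
    using integral_Re[OF mv(1)] mv(2) r by (simp only: ln[OF circ]) (simp add: ln)
qed

text \<open>
  The zeros are those of the entire function \<open>\<alpha> + \<beta> exp(i w)\<close> on the real line, hence countably many.
\<close>

lemma AE_uniform_angle_linear_nonzero:
  assumes "\<alpha> \<noteq> 0 \<or> \<beta> \<noteq> 0"
  shows "AE t in uniform_angle. \<alpha> + \<beta> * cis t \<noteq> 0"
proof -
  have "AE t in lborel. \<alpha> + \<beta> * cis t \<noteq> 0"
  proof (cases "\<beta> = 0")
    case False
    define F where "F = (\<lambda>w. \<alpha> + \<beta> * exp (\<i> * w))"
    have "\<not> F constant_on UNIV"
    proof
      assume "F constant_on UNIV"
      then have "F 0 = F (of_real pi)"
        by (auto simp: constant_on_def)
      then show False
        using False by (simp add: F_def)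
    qed
    moreover have "F holomorphic_on UNIV"
      unfolding F_def by (intro holomorphic_intros)
    ultimately have "countable {w \<in> UNIV. F w = 0}"
      by (intro holomorphic_countable_zeros) auto
    then have "countable (complex_of_real ` {t. F (of_real t) = 0})"
      by (rule countable_subset[rotated]) auto
    then have "countable {t. F (of_real t) = 0}"
      by (rule countable_image_inj_on) (auto intro: inj_onI)
    then have "{t. F (of_real t) = 0} \<in> null_sets lborel"
      by (rule countable_imp_null_set_lborel)
    then have "AE t in lborel. t \<notin> {t. F (of_real t) = 0}"
      by (rule AE_not_in)
    then show ?thesis
      by (simp add: F_def cis_conv_exp)
  qed (use assms in auto)
  then show ?thesis
    unfolding uniform_angle_eq_density by (auto simp: AE_density)
qed

section \<open>Logarithmic means for a single random atom\<close>

text \<open>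
  The value \<open>\<infinity>\<close> at 0 (where \<open>ln\<close> takes the default value 0) makes \<open>neg_log\<close> antitone on
  the nonnegative reals; moreover, a finite mean of \<open>neg_log |f|\<close> excludes that \<open>f\<close> vanishes on the circle
  identically.
\<close>

definition neg_log :: "real \<Rightarrow> ennreal" where
  "neg_log x = (if x = 0 then \<infinity> else ennreal (- ln x))"

lemma neg_log_measurable [measurable]: "neg_log \<in> borel_measurable borel"
  unfolding neg_log_def by measurable

lemma neg_log_antimono:
  assumes "0 \<le> x" "x \<le> y"
  shows "neg_log y \<le> neg_log x"
  using assms by (auto simp: neg_log_def intro!: ennreal_leI)

text \<open>
  Conjugation and multiplication by the unimodular number \<open>cis t\<close> exchange the two coefficients, so that the
  larger one may be assumed to be the constant term.
\<close>

lemma norm_linear_circle_swap: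
  "cmod (\<alpha> + \<beta> * cis t) = cmod (cnj \<beta> + cnj \<alpha> * cis t)"
proof -
  have "cnj \<beta> + cnj \<alpha> * cis t = cis t * cnj (\<alpha> + \<beta> * cis t)"
    by (simp add: algebra_simps cis_cnj cis_mult)
  then show ?thesis
    by (simp only: norm_mult complex_mod_cnj) simp
qed

text \<open>
  Jensen's formula for a linear function without zeros on the unit circle: if the constant term dominates, then
  the function is zero-free on a disk of radius greater than 1, and otherwise the coefficients can be
  exchanged.
\<close>

lemma mean_ln_norm_linear:
  assumes "cmod \<alpha> \<noteq> cmod \<beta>"
  shows "integrable uniform_angle (\<lambda>t. ln (cmod (\<alpha> + \<beta> * cis t)))" (is ?P)
    and "(\<integral>t. ln (cmod (\<alpha> + \<beta> * cis t)) \<partial>uniform_angle) = ln (max (cmod \<alpha>) (cmod \<beta>))" (is ?Q)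
proof -
  have *: "integrable uniform_angle (\<lambda>t. ln (cmod (\<alpha> + \<beta> * cis t))) \<and>
      (\<integral>t. ln (cmod (\<alpha> + \<beta> * cis t)) \<partial>uniform_angle) = ln (cmod \<alpha>)"
    if less: "cmod \<beta> < cmod \<alpha>" for \<alpha> \<beta>
  proof -
    \<comment> \<open>The zero of \<open>\<alpha> + \<beta> w\<close> has modulus \<open>|\<alpha> / \<beta>|\<close>; if \<open>\<beta> = 0\<close>, any radius greater than 1 serves.\<close>
    define R where "R = (if \<beta> = 0 then 2 else cmod \<alpha> / cmod \<beta>)"
    have R: "1 < R"
      using less by (simp add: R_def)
    have nz: "\<alpha> + \<beta> * w \<noteq> 0" if "w \<in> ball 0 R" for w
    proof
      assume "\<alpha> + \<beta> * w = 0"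
      then have "cmod \<alpha> = cmod \<beta> * cmod w"
        by (metis add_eq_0_iff norm_minus_cancel norm_mult)
      then show False
        using that less by (auto simp: R_def field_simps split: if_splits)
    qed
    have hol: "(\<lambda>w. \<alpha> + \<beta> * w) holomorphic_on ball 0 R"
      by (intro holomorphic_intros)
    from mean_value_ln_norm[OF hol nz zero_less_one R] show ?thesis
      by simp
  qed
  show ?P ?Q
    using *[of \<beta> \<alpha>] *[of "cnj \<alpha>" "cnj \<beta>"] assms norm_linear_circle_swap[of \<alpha> \<beta>]
    by (cases "cmod \<alpha>" "cmod \<beta>" rule: linorder_cases; simp)+
qed

text \<open>
  If \<open>|\<alpha>| = |\<beta>|\<close>, then the zero lies on the circle. Shrinking \<open>\<beta>\<close> slightly moves it off the circle, and
  Fatou's lemma for \<open>ln (2 |\<alpha>|) - ln |\<alpha> + s \<beta> cis t|\<close>, which is nonnegative, gives integrability together with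
  the inequality in the limit \<open>s \<rightarrow> 1\<close>.
\<close>

lemma mean_ln_norm_linear_ge:
  assumes "\<alpha> \<noteq> 0 \<or> \<beta> \<noteq> 0"
  shows "integrable uniform_angle (\<lambda>t. ln (cmod (\<alpha> + \<beta> * cis t)))" (is ?P)
    and "ln (max (cmod \<alpha>) (cmod \<beta>)) \<le> (\<integral>t. ln (cmod (\<alpha> + \<beta> * cis t)) \<partial>uniform_angle)" (is ?Q)
proof -
  interpret prob_space uniform_angle by (rule prob_space_uniform_angle)
  have "?P \<and> ?Q"
  proof (cases "cmod \<alpha> = cmod \<beta>")
    case True
    define a where "a = cmod \<alpha>"
    have a: "cmod \<alpha> = a" "cmod \<beta> = a" "0 < a"
      using True assms by (auto simp: a_def)
    define s where "s j = 1 - inverse (real (Suc (Suc j)))" for j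
    have s: "0 < s j" "s j < 1" for j
      by (auto simp: s_def inverse_less_1_iff)
    have s_lim: "s \<longlonglongrightarrow> 1"
      unfolding s_def by real_asymp
    have bound: "cmod (\<alpha> + u * \<beta> * cis t) \<le> 2 * a" if "0 \<le> u" "u \<le> 1" for t u :: real
    proof -
      have "cmod (\<alpha> + u * \<beta> * cis t) \<le> a + u * a"
        using that norm_triangle_ineq[of \<alpha> "u * \<beta> * cis t"] a by (simp add: norm_mult)
      also have "\<dots> \<le> 2 * a"
        using that a by (simp add: mult_left_le_one_le)
      finally show ?thesis .
    qed
    define f where "f t = ln (2 * a) - ln (cmod (\<alpha> + \<beta> * cis t))" for t
    define g where "g j t = ln (2 * a) - ln (cmod (\<alpha> + s j * \<beta> * cis t))" for j t
    have nz: "AE t in uniform_angle. \<alpha> + \<beta> * cis t \<noteq> 0"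
      by (rule AE_uniform_angle_linear_nonzero[OF assms])
    have f_nonneg: "AE t in uniform_angle. 0 \<le> f t"
      using nz by eventually_elim (use bound[of 1] a in \<open>auto simp: f_def\<close>)
    have less: "cmod (s j * \<beta>) < cmod \<alpha>" for j
      using s[of j] a by (simp add: norm_mult)
    have nn_g: "(\<integral>\<^sup>+t. ennreal (g j t) \<partial>uniform_angle) = ennreal (ln 2)" for j
    proof -
      have g_nonneg: "0 \<le> g j t" for t
      proof -
        have "cmod (s j * \<beta> * cis t) < cmod \<alpha>"
          using less[of j] by (simp add: norm_mult)
        then have "\<alpha> + s j * \<beta> * cis t \<noteq> 0"
          by (metis add_eq_0_iff less_irrefl norm_minus_cancel)
        then show ?thesis
          using bound[of "s j" t] s[of j] a by (simp add: g_def)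
      qed
      note m = mean_ln_norm_linear[of \<alpha> "s j * \<beta>"]
      have "integrable uniform_angle (g j)"
        unfolding g_def using m(1) less[of j] by (intro Bochner_Integration.integrable_diff) auto
      then have "(\<integral>\<^sup>+t. ennreal (g j t) \<partial>uniform_angle) = ennreal (\<integral>t. g j t \<partial>uniform_angle)"
        using g_nonneg by (intro nn_integral_eq_integral) auto
      also have "(\<integral>t. g j t \<partial>uniform_angle) = ln (2 * a) - ln a"
        unfolding g_def using m less[of j] a
        by (subst Bochner_Integration.integral_diff) (auto simp: max_def prob_space)
      also have "\<dots> = ln 2"
        using a by (simp add: ln_mult)
      finally show ?thesis .
    qed
    have "(\<integral>\<^sup>+t. ennreal (f t) \<partial>uniform_angle)
        \<le> (\<integral>\<^sup>+t. liminf (\<lambda>j. ennreal (g j t)) \<partial>uniform_angle)"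
    proof (rule nn_integral_mono_AE)
      show "AE t in uniform_angle. ennreal (f t) \<le> liminf (\<lambda>j. ennreal (g j t))"
        using nz
      proof eventually_elim
        case (elim t)
        have "(\<lambda>j. \<alpha> + s j * \<beta> * cis t) \<longlonglongrightarrow> \<alpha> + of_real 1 * \<beta> * cis t"
          by (intro tendsto_intros s_lim)
        then have "(\<lambda>j. g j t) \<longlonglongrightarrow> f t"
          unfolding f_def g_def using elim
          by (intro tendsto_diff tendsto_const tendsto_ln tendsto_norm) auto
        then have "(\<lambda>j. ennreal (g j t)) \<longlonglongrightarrow> ennreal (f t)"
          by (rule tendsto_ennrealI)
        then show ?case
          by (simp add: lim_imp_Liminf)
      qed
    qed
    also have "\<dots> \<le> liminf (\<lambda>j. \<integral>\<^sup>+t. ennreal (g j t) \<partial>uniform_angle)"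
      by (intro nn_integral_liminf) (simp add: g_def)
    also have "\<dots> = ennreal (ln 2)"
      by (simp add: nn_g Liminf_const)
    finally have le: "(\<integral>\<^sup>+t. ennreal (f t) \<partial>uniform_angle) \<le> ennreal (ln 2)" .
    have f_meas [measurable]: "f \<in> borel_measurable uniform_angle"
      by (simp add: f_def[abs_def])
    have int: "integrable uniform_angle f"
      using le f_nonneg by (intro integrableI_nonneg) (auto simp: less_top[symmetric] top_unique)
    have "(\<integral>t. f t \<partial>uniform_angle) \<le> ln 2"
      using le nn_integral_eq_integral[OF int f_nonneg] by (simp add: ennreal_le_iff)
    moreover have eq: "ln (cmod (\<alpha> + \<beta> * cis t)) = ln (2 * a) - f t" for t
      by (simp add: f_def)
    ultimately show ?thesis
      using int a by (simp add: eq prob_space ln_mult)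
  qed (simp add: mean_ln_norm_linear)
  then show ?P ?Q
    by auto
qed

lemma mean_neg_log_ratio:
  assumes D: "\<alpha> \<noteq> 0 \<or> \<beta> \<noteq> 0" and N: "cmod \<alpha>' \<noteq> cmod \<beta>'"
    and le: "\<And>t. cmod (\<alpha> + \<beta> * cis t) \<le> cmod (\<alpha>' + \<beta>' * cis t)"
  shows "(\<integral>\<^sup>+t. neg_log (cmod (\<alpha> + \<beta> * cis t) / cmod (\<alpha>' + \<beta>' * cis t)) \<partial>uniform_angle)
      \<le> ennreal (ln (max (cmod \<alpha>') (cmod \<beta>')) - ln (max (cmod \<alpha>) (cmod \<beta>)))"
proof -
  define f where "f t = ln (cmod (\<alpha>' + \<beta>' * cis t)) - ln (cmod (\<alpha> + \<beta> * cis t))" for t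
  have nz: "AE t in uniform_angle. \<alpha> + \<beta> * cis t \<noteq> 0"
    by (rule AE_uniform_angle_linear_nonzero[OF D])
  have "AE t in uniform_angle.
      neg_log (cmod (\<alpha> + \<beta> * cis t) / cmod (\<alpha>' + \<beta>' * cis t)) = ennreal (f t)"
    using nz
  proof eventually_elim
    case (elim t)
    then have "\<alpha>' + \<beta>' * cis t \<noteq> 0"
      using le[of t] by auto
    with elim show ?case
      by (simp add: neg_log_def f_def ln_div)
  qed
  then have "(\<integral>\<^sup>+t. neg_log (cmod (\<alpha> + \<beta> * cis t) / cmod (\<alpha>' + \<beta>' * cis t)) \<partial>uniform_angle)
      = (\<integral>\<^sup>+t. ennreal (f t) \<partial>uniform_angle)"
    by (rule nn_integral_cong_AE)
  also have "\<dots> = ennreal (\<integral>t. f t \<partial>uniform_angle)"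
  proof (rule nn_integral_eq_integral)
    show "integrable uniform_angle f"
      unfolding f_def
      by (intro Bochner_Integration.integrable_diff mean_ln_norm_linear(1) mean_ln_norm_linear_ge(1) D N)
    show "AE t in uniform_angle. 0 \<le> f t"
      using nz by eventually_elim
        (use le in \<open>auto simp: f_def intro!: ln_mono intro: less_le_trans[of 0]\<close>)
  qed
  also have "(\<integral>t. f t \<partial>uniform_angle) \<le> ln (max (cmod \<alpha>') (cmod \<beta>')) - ln (max (cmod \<alpha>) (cmod \<beta>))"
    unfolding f_def using mean_ln_norm_linear[OF N] mean_ln_norm_linear_ge[OF D]
    by (subst Bochner_Integration.integral_diff) auto
  finally show ?thesis
    by (simp add: ennreal_leI)
qed

text \<open>
  For \<open>Re y \<le> 1\<close> the first entry of the maximum suffices: \<open>|c + 1 - y| \<ge> c\<close>, and the squares of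
  \<open>|c + 1 + y|\<close> and \<open>|c + 1 - y|\<close> differ by \<open>4 (1 + c) Re y\<close>. For \<open>Re y > 1\<close> a constant bound is enough; it
  exists because the two entries cannot both be small, the sum of \<open>c + 1 - y\<close> and \<open>c + y - 1\<close> being \<open>2 c\<close>.
\<close>

lemma ln_ratio_bound:
  fixes y :: complex
  assumes c: "0 < c" "c \<le> 1" and y: "0 \<le> Re y" and r: "1/2 \<le> r" "r < 1"
  shows "ln (cmod (c + y + 1)) - ln (max (r * cmod (c + 1 - y)) (cmod (c + y - 1)))
      \<le> - ln r + 4 / c\<^sup>2 * min 1 (Re y)"
proof -
  define A where "A = cmod (c + y + 1)"
  define B where "B = cmod (c + 1 - y)"
  define m where "m = max (r * B) (cmod (c + y - 1))"
  have A: "1 \<le> A"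
    using complex_Re_le_cmod[of "c + y + 1"] c y by (simp add: A_def)
  have m2: "r * c \<le> m"
  proof -
    have "(c + 1 - y) + (c + y - 1) = complex_of_real (2 * c)"
      by simp
    then have "2 * c = cmod ((c + 1 - y) + (c + y - 1))"
      using c by (simp only: norm_of_real)
    also have "\<dots> \<le> B + cmod (c + y - 1)"
      unfolding B_def by (rule norm_triangle_ineq)
    finally have "2 * (r * c) \<le> r * B + r * cmod (c + y - 1)"
      using mult_left_mono[of "2 * c" "B + cmod (c + y - 1)" r] r by (simp add: algebra_simps)
    also have "r * cmod (c + y - 1) \<le> cmod (c + y - 1)"
      using r by (simp add: mult_left_le_one_le)
    finally show ?thesis
      by (simp add: m_def)
  qed
  have m: "0 < m"
    by (rule less_le_trans[OF _ m2]) (use c r in simp)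
  have "ln A - ln m \<le> - ln r + 4 / c\<^sup>2 * min 1 (Re y)"
  proof (cases "Re y \<le> 1")
    case True
    have B: "c \<le> B"
      using complex_Re_le_cmod[of "c + 1 - y"] True by (simp add: B_def)
    have "A\<^sup>2 = B\<^sup>2 + 4 * (1 + c) * Re y"
      by (simp add: A_def B_def cmod_power2) (simp add: power2_eq_square algebra_simps)
    also have "\<dots> \<le> B\<^sup>2 + 8 * Re y"
      using c y by (simp add: mult_right_mono)
    finally have "(A / B)\<^sup>2 \<le> 1 + 8 * Re y / B\<^sup>2"
      using B c by (simp add: power_divide field_simps)
    also have "\<dots> \<le> 1 + 8 * Re y / c\<^sup>2"
      using B c y by (intro add_left_mono divide_left_mono power_mono) auto
    finally have "ln ((A / B)\<^sup>2) \<le> ln (1 + 8 * Re y / c\<^sup>2)"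
      using A B c by (intro ln_mono) auto
    also have "\<dots> \<le> 8 * Re y / c\<^sup>2"
      using y c by (intro ln_add_one_self_le_self) auto
    finally have "2 * (ln A - ln B) \<le> 8 * Re y / c\<^sup>2"
      using A B c by (simp add: ln_realpow ln_div)
    moreover have "ln (r * B) \<le> ln m"
      using r B c by (intro ln_mono) (auto simp: m_def)
    then have "ln r + ln B \<le> ln m"
      using r B c by (simp add: ln_mult)
    ultimately show ?thesis
      using True by (simp add: min_def)
  next
    case False
    have "A = cmod ((c + y - 1) + 2)"
      unfolding A_def by (rule arg_cong[where f = cmod]) simp
    also have "\<dots> \<le> m + 2"
      using norm_triangle_ineq[of "c + y - 1" 2] by (simp add: m_def)
    finally have "A / m \<le> 1 + 2 / m"
      using m by (simp add: field_simps)
    then have "ln (A / m) \<le> ln (1 + 2 / m)"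
      using A m by (intro ln_mono) auto
    also have "\<dots> \<le> 2 / m"
      using m by (intro ln_add_one_self_le_self) auto
    also have "\<dots> \<le> 2 / (r * c)"
      using m m2 c r by (intro divide_left_mono) auto
    also have "\<dots> \<le> 2 / (1/2 * c\<^sup>2)"
    proof (rule divide_left_mono)
      show "1/2 * c\<^sup>2 \<le> r * c"
        using c r by (auto simp: power2_eq_square intro!: mult_mono[of "1/2" r "c*c" c] mult_left_le)
    qed (use c r in auto)
    finally have "ln A - ln m \<le> 4 / c\<^sup>2"
      using A m by (simp add: ln_div)
    moreover have "0 \<le> - ln r"
      using r by simp
    ultimately show ?thesis
      using False by simp
  qed
  then show ?thesis
    by (simp add: A_def B_def m_def)
qed

lemma cmod_minus_1_le_plus_1: "0 \<le> Re w \<Longrightarrow> cmod (w - 1) \<le> cmod (w + 1)"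
  by (rule power2_le_imp_le, unfold cmod_power2) (simp_all add: power2_eq_square algebra_simps)

lemma Re_herglotz_kernel:
  assumes "cmod \<zeta> = 1" "cmod z < 1"
  shows "Re ((\<zeta> + z) / (\<zeta> - z)) = (1 - (cmod z)\<^sup>2) / (cmod (\<zeta> - z))\<^sup>2"
proof -
  have "(\<zeta> + z) / (\<zeta> - z) = ((\<zeta> + z) * cnj (\<zeta> - z)) / of_real ((cmod (\<zeta> - z))\<^sup>2)"
    by (subst complex_div_cnj) (simp only: complex_norm_square[symmetric])
  then have "Re ((\<zeta> + z) / (\<zeta> - z)) = Re ((\<zeta> + z) * cnj (\<zeta> - z)) / (cmod (\<zeta> - z))\<^sup>2"
    by (simp only: Re_divide_of_real)
  also have "Re ((\<zeta> + z) * cnj (\<zeta> - z)) = (cmod \<zeta>)\<^sup>2 - (cmod z)\<^sup>2"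
    unfolding cmod_power2 by (simp add: power2_eq_square algebra_simps)
  finally show ?thesis
    using assms by simp
qed

lemma Re_herglotz_kernel_nonneg:
  assumes "cmod \<zeta> = 1" "cmod z < 1"
  shows "0 \<le> Re ((\<zeta> + z) / (\<zeta> - z))"
  unfolding Re_herglotz_kernel[OF assms]
  using assms by (simp add: abs_square_le_1)

text \<open>
  After multiplication by \<open>cis t - z\<close>, the numbers \<open>H t - 1\<close> and \<open>H t + 1\<close> become linear in \<open>cis t\<close>. The
  numerator may vanish on the circle, where Jensen's formula is only used as an inequality; the
  denominator does not vanish there, because \<open>|c - y - 1| \<le> |c + y + 1|\<close> and \<open>|z| < 1\<close>.
\<close>

lemma mean_neg_log_one_atom:
  fixes y z :: complex
  assumes c: "0 < c" "c \<le> 1" and y: "0 \<le> Re y" and z: "1/2 \<le> cmod z" "cmod z < 1"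
  defines "H t \<equiv> of_real c * ((cis t + z) / (cis t - z)) + y"
  shows "(\<integral>\<^sup>+t. neg_log (cmod ((H t - 1) / (H t + 1))) \<partial>uniform_angle)
      \<le> ennreal (- ln (cmod z) + 4 / c\<^sup>2 * min 1 (Re y))"
proof -
  define \<alpha> where "\<alpha> = (c + 1 - y) * z"
  define \<beta> where "\<beta> = c + y - 1"
  define \<alpha>' where "\<alpha>' = (c - y - 1) * z"
  define \<beta>' where "\<beta>' = c + y + 1"
  have nz: "cis t - z \<noteq> 0" for t
    using z by (metis eq_iff_diff_eq_0 norm_cis less_irrefl)
  have D: "H t - 1 = (\<alpha> + \<beta> * cis t) / (cis t - z)" for t
    using nz[of t] by (simp add: H_def \<alpha>_def \<beta>_def field_simps)
  have N: "H t + 1 = (\<alpha>' + \<beta>' * cis t) / (cis t - z)" for t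
    using nz[of t] by (simp add: H_def \<alpha>'_def \<beta>'_def field_simps)
  have Re_H: "0 \<le> Re (H t)" for t
  proof -
    have "0 \<le> c * Re ((cis t + z) / (cis t - z))"
      using c z by (intro mult_nonneg_nonneg Re_herglotz_kernel_nonneg) auto
    then show ?thesis
      using y by (simp add: H_def del: times_divide_eq_right)
  qed
  have quot: "cmod ((H t - 1) / (H t + 1)) = cmod (\<alpha> + \<beta> * cis t) / cmod (\<alpha>' + \<beta>' * cis t)" for t
    using nz[of t] by (simp add: D N norm_divide)
  have le: "cmod (\<alpha> + \<beta> * cis t) \<le> cmod (\<alpha>' + \<beta>' * cis t)" for t
    using cmod_minus_1_le_plus_1[OF Re_H[of t]] nz[of t]
    by (simp add: D N norm_divide divide_le_cancel)
  have nonzero: "\<alpha> \<noteq> 0 \<or> \<beta> \<noteq> 0"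
  proof (rule ccontr)
    assume "\<not> ?thesis"
    then have "(c + 1 - y) + (c + y - 1) = 0"
      using z by (auto simp: \<alpha>_def \<beta>_def)
    then show False
      using c by simp
  qed
  have "cmod \<alpha>' < cmod \<beta>'"
  proof -
    have "cmod (c - y - 1) \<le> cmod \<beta>'"
      unfolding \<beta>'_def
      by (rule power2_le_imp_le, unfold cmod_power2)
        (use c y in \<open>simp_all add: power2_eq_square algebra_simps\<close>)
    then have "cmod (c - y - 1) * cmod z \<le> cmod \<beta>' * cmod z"
      by (rule mult_right_mono) simp
    moreover have "0 < Re \<beta>'"
      using c y by (simp add: \<beta>'_def)
    then have "0 < cmod \<beta>'"
      using complex_Re_le_cmod[of \<beta>'] by (rule less_le_trans)
    then have "cmod \<beta>' * cmod z < cmod \<beta>'"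
      using z by simp
    ultimately show ?thesis
      by (simp only: \<alpha>'_def norm_mult)
  qed
  then have "cmod \<alpha>' \<noteq> cmod \<beta>'" "max (cmod \<alpha>') (cmod \<beta>') = cmod \<beta>'"
    by auto
  then have "(\<integral>\<^sup>+t. neg_log (cmod ((H t - 1) / (H t + 1))) \<partial>uniform_angle)
      \<le> ennreal (ln (cmod \<beta>') - ln (max (cmod \<alpha>) (cmod \<beta>)))"
    using mean_neg_log_ratio[OF nonzero _ le] by (simp only: quot not_False_eq_True)
  also have "\<dots> \<le> ennreal (- ln (cmod z) + 4 / c\<^sup>2 * min 1 (Re y))"
    using ln_ratio_bound[OF c y z]
    by (intro ennreal_leI) (simp add: \<alpha>_def \<beta>_def \<beta>'_def norm_mult mult.commute)
  finally show ?thesis .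
qed

section \<open>Schur functions and their zeros\<close>

definition schur :: "(complex \<Rightarrow> complex) \<Rightarrow> bool" where
  "schur g \<longleftrightarrow> g holomorphic_on ball 0 1 \<and> (\<forall>z\<in>ball 0 1. cmod (g z) \<le> 1)"

text \<open>
  The Schwarz lemma asks for strict bounds, but quotients of Schur functions by Blaschke factors
  may be unimodular constants. Scaling by \<open>s < 1\<close> and letting \<open>s \<rightarrow> 1\<close> avoids a case distinction.
\<close>

lemma schur_scaled_less:
  assumes "schur g" "0 < s" "s < 1" "cmod z < 1"
  shows "cmod (of_real s * g z) < 1"
proof -
  have "s * cmod (g z) \<le> s"
    using assms by (intro mult_left_le) (auto simp: schur_def)
  then have "s * cmod (g z) < 1"
    using assms(3) by (rule le_less_trans)
  then show ?thesis
    using assms by (simp add: norm_mult)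
qed

text \<open>
  The Schwarz lemma for \<open>s g\<close> composed with the disk automorphism that takes 0 to \<open>a\<close>.
\<close>

lemma schwarz_pick_zero:
  assumes g: "schur g" and a: "cmod a < 1" "g a = 0" and z: "cmod z < 1"
  shows "cmod (g z) \<le> cmod ((z - a) / (1 - cnj a * z))"
proof (rule field_le_mult_one_interval)
  fix s :: real assume s: "0 < s" "s < 1"
  define \<psi> where "\<psi> = Moebius_function 0 (- a)"
  define \<xi> where "\<xi> = Moebius_function 0 a z"
  have \<psi>: "cmod (\<psi> w) < 1" if "cmod w < 1" for w
    unfolding \<psi>_def using a that by (intro Moebius_function_norm_lt_1) auto
  have "(\<lambda>w. of_real s * g (\<psi> w)) holomorphic_on ball 0 1"
  proof (rule holomorphic_on_mult[OF holomorphic_on_const],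
      rule holomorphic_on_compose_gen[of \<psi> _ g "ball 0 1", unfolded o_def])
    show "\<psi> holomorphic_on ball 0 1"
      unfolding \<psi>_def using a by (intro Moebius_function_holomorphic) auto
  qed (use g \<psi> in \<open>auto simp: schur_def\<close>)
  moreover have "of_real s * g (\<psi> 0) = 0"
    using a by (simp add: \<psi>_def Moebius_function_of_zero)
  moreover have "cmod (of_real s * g (\<psi> w)) < 1" if "cmod w < 1" for w
    using schur_scaled_less[OF g s \<psi>[OF that]] .
  moreover have "cmod \<xi> < 1"
    unfolding \<xi>_def by (rule Moebius_function_norm_lt_1[OF a(1) z])
  ultimately have "cmod (of_real s * g (\<psi> \<xi>)) \<le> cmod \<xi>"
    by (rule Schwarz_Lemma(1))
  also have "\<psi> \<xi> = z"
    unfolding \<psi>_def \<xi>_def using a z by (intro Moebius_function_compose) auto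
  finally show "s * cmod (g z) \<le> cmod ((z - a) / (1 - cnj a * z))"
    using s by (simp add: norm_mult \<xi>_def Moebius_function_simple)
qed

lemma one_minus_cnj_mult_nonzero:
  assumes "cmod a < 1" "cmod z < 1"
  shows "1 - cnj a * z \<noteq> 0"
proof -
  have "cmod (cnj a * z) < 1"
    using assms norm_mult_less[of "cnj a" 1 z 1] by simp
  then show ?thesis
    by auto
qed

text \<open>
  Outside \<open>a\<close> the quotient is bounded by the Schwarz-Pick inequality, and at \<open>a\<close> by
  continuity. The value \<open>a = 0\<close> is included, where the divisor is \<open>z\<close>.
\<close>

lemma schur_divide_zero:
  assumes g: "schur g" and a: "cmod a < 1" "g a = 0"
  shows "\<exists>k. schur k \<and> (\<forall>z. cmod z < 1 \<longrightarrow> g z = (z - a) / (1 - cnj a * z) * k z)"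
proof -
  define q where "q z = (if z = a then deriv g a else (g z - g a) / (z - a))" for z
  define k where "k z = (1 - cnj a * z) * q z" for z
  have q: "q holomorphic_on ball 0 1"
    unfolding q_def using g by (intro pole_lemma_open) (auto simp: schur_def)
  then have k: "k holomorphic_on ball 0 1"
    unfolding k_def by (intro holomorphic_intros)
  have eq: "g z = (z - a) / (1 - cnj a * z) * k z" if "cmod z < 1" for z
    using one_minus_cnj_mult_nonzero[OF a(1) that] a by (simp add: k_def q_def)
  have le: "cmod (k z) \<le> 1" if "cmod z < 1" "z \<noteq> a" for z
  proof -
    define b where "b = (z - a) / (1 - cnj a * z)"
    have "b \<noteq> 0"
      using that one_minus_cnj_mult_nonzero[OF a(1) that(1)] by (simp add: b_def)
    moreover have "cmod (g z) = cmod b * cmod (k z)"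
      using eq[OF that(1)] by (simp only: b_def norm_mult)
    then have "cmod b * cmod (k z) \<le> cmod b * 1"
      using schwarz_pick_zero[OF g a that(1)] by (simp only: b_def mult_1_right)
    ultimately show ?thesis
      by (metis mult_le_cancel_left_pos zero_less_norm_iff)
  qed
  have le_a: "cmod (k a) \<le> 1"
  proof (rule tendsto_upperbound)
    have "isCont k a"
      using k a by (auto intro!: continuous_on_interior[of "ball 0 1"] holomorphic_on_imp_continuous_on
          simp: interior_open)
    then show "((\<lambda>z. cmod (k z)) \<longlongrightarrow> cmod (k a)) (at a)"
      by (intro tendsto_norm) (simp add: isCont_def)
    have "eventually (\<lambda>z. z \<in> ball 0 1) (at a)"
      using a by (intro eventually_at_in_open') auto
    moreover have "eventually (\<lambda>z. z \<noteq> a) (at a)"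
      by (simp add: eventually_at_filter)
    ultimately show "eventually (\<lambda>z. cmod (k z) \<le> 1) (at a)"
      by eventually_elim (simp add: le)
  qed simp
  have "schur k"
    unfolding schur_def using k
  proof (intro conjI ballI)
    show "cmod (k z) \<le> 1" if "z \<in> ball 0 1" for z
      using le[of z] le_a that by (cases "z = a") auto
  qed
  then show ?thesis
    using eq by auto
qed

text \<open>
  A Schur function whose value at 0 is nearly unimodular is nearly constant. Composing \<open>s g\<close> with the
  automorphism that takes \<open>\<gamma> = s g(0)\<close> to 0, the Schwarz lemma yields \<open>|u - \<gamma>| \<le> |z| |1 - cnj \<gamma> u|\<close> for
  \<open>u = s g(z)\<close>, and \<open>1 - cnj \<gamma> u = 1 - |\<gamma>|\<^sup>2 - cnj \<gamma> (u - \<gamma>)\<close>.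
\<close>

lemma schur_dist_center_le:
  assumes g: "schur g" and z: "cmod z < 1"
  shows "cmod (g z - g 0) \<le> (1 - (cmod (g 0))\<^sup>2) * (cmod z / (1 - cmod z))"
proof -
  define s where "s j = 1 - inverse (real (Suc (Suc j)))" for j
  have s: "0 < s j" "s j < 1" for j
    by (auto simp: s_def inverse_less_1_iff)
  have s_lim: "s \<longlonglongrightarrow> 1"
    unfolding s_def by real_asymp
  have bound: "s j * cmod (g z - g 0) \<le> (1 - (s j * cmod (g 0))\<^sup>2) * (cmod z / (1 - cmod z))" for j
  proof -
    define \<gamma> where "\<gamma> = of_real (s j) * g 0"
    define u where "u = of_real (s j) * g z"
    note less = schur_scaled_less[OF g s]
    have \<gamma>: "cmod \<gamma> < 1"
      using less[of 0] by (simp add: \<gamma>_def)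
    have u: "cmod u < 1"
      using less[OF z] by (simp add: u_def)
    define F where "F w = Moebius_function 0 \<gamma> (of_real (s j) * g w)" for w
    have "F holomorphic_on ball 0 1"
      unfolding F_def
    proof (rule holomorphic_on_compose_gen[of "\<lambda>w. of_real (s j) * g w" _ "Moebius_function 0 \<gamma>" "ball 0 1",
          unfolded o_def])
      show "(\<lambda>w. of_real (s j) * g w) holomorphic_on ball 0 1"
        using g by (intro holomorphic_intros) (simp add: schur_def)
    qed (use less \<gamma> in \<open>auto intro!: Moebius_function_holomorphic\<close>)
    moreover have "F 0 = 0"
      by (simp add: F_def \<gamma>_def Moebius_function_eq_zero)
    moreover have "cmod (F w) < 1" if "cmod w < 1" for w
      unfolding F_def by (rule Moebius_function_norm_lt_1[OF \<gamma> less[OF that]])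
    ultimately have "cmod (F z) \<le> cmod z"
      using z by (rule Schwarz_Lemma(1))
    then have "cmod (u - \<gamma>) \<le> cmod z * cmod (1 - cnj \<gamma> * u)"
      using one_minus_cnj_mult_nonzero[OF \<gamma> u]
      by (simp add: F_def u_def Moebius_function_simple norm_divide divide_le_eq)
    also have "cmod (1 - cnj \<gamma> * u) \<le> (1 - (cmod \<gamma>)\<^sup>2) + cmod (u - \<gamma>)"
    proof -
      have "1 - cnj \<gamma> * u = of_real (1 - (cmod \<gamma>)\<^sup>2) - cnj \<gamma> * (u - \<gamma>)"
        using complex_norm_square[of \<gamma>] by (simp add: algebra_simps)
      then have "cmod (1 - cnj \<gamma> * u) \<le> cmod (of_real (1 - (cmod \<gamma>)\<^sup>2)) + cmod (cnj \<gamma> * (u - \<gamma>))"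
        by (simp only: norm_triangle_ineq4)
      also have "cmod (of_real (1 - (cmod \<gamma>)\<^sup>2)) = 1 - (cmod \<gamma>)\<^sup>2"
        using \<gamma> by (simp only: norm_of_real) (simp add: abs_square_le_1)
      also have "cmod (cnj \<gamma> * (u - \<gamma>)) \<le> cmod (u - \<gamma>)"
        using \<gamma> by (simp add: norm_mult mult_left_le_one_le)
      finally show ?thesis
        by simp
    qed
    finally have "cmod (u - \<gamma>) \<le> cmod z * ((1 - (cmod \<gamma>)\<^sup>2) + cmod (u - \<gamma>))"
      by (simp add: mult_left_mono)
    then have "cmod (u - \<gamma>) \<le> (1 - (cmod \<gamma>)\<^sup>2) * (cmod z / (1 - cmod z))"
      using z by (simp add: field_simps)
    moreover have "cmod (u - \<gamma>) = s j * cmod (g z - g 0)"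
      using s[of j] by (simp add: u_def \<gamma>_def norm_mult flip: right_diff_distrib)
    moreover have "cmod \<gamma> = s j * cmod (g 0)"
      using s[of j] by (simp add: \<gamma>_def norm_mult)
    ultimately show ?thesis
      by simp
  qed
  have "(\<lambda>j. s j * cmod (g z - g 0)) \<longlonglongrightarrow> 1 * cmod (g z - g 0)"
    by (intro tendsto_intros s_lim)
  moreover have "(\<lambda>j. (1 - (s j * cmod (g 0))\<^sup>2) * (cmod z / (1 - cmod z)))
      \<longlonglongrightarrow> (1 - (1 * cmod (g 0))\<^sup>2) * (cmod z / (1 - cmod z))"
    by (intro tendsto_mult tendsto_diff tendsto_power tendsto_const s_lim)
  ultimately show ?thesis
    using LIMSEQ_le[of "\<lambda>j. s j * cmod (g z - g 0)"] bound by simp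
qed

text \<open>
  Factors \<open>z\<close> can be split off as long as the quotient vanishes at 0. This must end: \<open>f = z ^ m * g\<close>
  with a Schur function \<open>g\<close> gives \<open>|f(z\<^sub>0)| \<le> |z\<^sub>0| ^ m\<close>.
\<close>

lemma schur_factor_power:
  assumes f: "schur f" and nz: "cmod z\<^sub>0 < 1" "f z\<^sub>0 \<noteq> 0"
  shows "\<exists>m g. schur g \<and> g 0 \<noteq> 0 \<and> (\<forall>z. cmod z < 1 \<longrightarrow> f z = z ^ m * g z)"
proof (rule ccontr)
  assume contra: "\<not> ?thesis"
  have ex: "\<exists>g. schur g \<and> (\<forall>z. cmod z < 1 \<longrightarrow> f z = z ^ m * g z)" for m
  proof (induction m)
    case 0
    then show ?case
      using f by (intro exI[of _ f]) simp
  next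
    case (Suc m)
    then obtain g where g: "schur g" "\<forall>z. cmod z < 1 \<longrightarrow> f z = z ^ m * g z"
      by blast
    with contra have "g 0 = 0"
      by blast
    then obtain k where "schur k" "\<forall>z. cmod z < 1 \<longrightarrow> g z = (z - 0) / (1 - cnj 0 * z) * k z"
      using schur_divide_zero[OF g(1), of 0] by auto
    then show ?case
      using g(2) by (intro exI[of _ k]) simp
  qed
  have bound: "cmod (f z\<^sub>0) \<le> cmod z\<^sub>0 ^ m" for m
  proof -
    obtain g where "schur g" "f z\<^sub>0 = z\<^sub>0 ^ m * g z\<^sub>0"
      using ex[of m] nz by blast
    then show ?thesis
      using nz by (simp add: norm_mult norm_power schur_def mult_left_le)
  qed
  have "(\<lambda>m. cmod z\<^sub>0 ^ m) \<longlonglongrightarrow> 0"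
    using nz by (intro LIMSEQ_power_zero) auto
  then have "cmod (f z\<^sub>0) \<le> 0"
    using bound by (intro LIMSEQ_le_const) auto
  then show False
    using nz by simp
qed

lemma schur_divide_blaschke_factor:
  assumes g: "schur g" and a: "a \<noteq> 0" "cmod a < 1" "g a = 0"
  shows "\<exists>k. schur k \<and> (\<forall>z. cmod z < 1 \<longrightarrow> g z = blaschke_factor a z * k z)"
proof -
  obtain k where k: "schur k" and k_eq: "\<And>z. cmod z < 1 \<Longrightarrow> g z = (z - a) / (1 - cnj a * z) * k z"
    using schur_divide_zero[OF g a(2,3)] by auto
  define l where "l z = - (a / of_real (cmod a)) * k z" for z
  have "schur l"
    using k a(1) unfolding schur_def l_def
    by (auto intro!: holomorphic_intros simp: norm_mult norm_divide)
  have "g z = blaschke_factor a z * l z" if "cmod z < 1" for z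
  proof -
    define p where "p = complex_of_real (cmod a)"
    define d where "d = 1 - cnj a * z"
    have "p \<noteq> 0" "d \<noteq> 0"
      using a(1) one_minus_cnj_mult_nonzero[OF a(2) that] by (simp_all add: p_def d_def)
    then have "(p / a) * ((a - z) / d) * (- (a / p) * k z) = - ((a - z) / d * k z)"
      using a(1) by simp
    also have "\<dots> = (z - a) / d * k z"
      by (metis minus_diff_eq minus_divide_left mult_minus_left)
    finally show ?thesis
      unfolding k_eq[OF that] blaschke_factor_def l_def p_def d_def by (rule sym)
  qed
  with \<open>schur l\<close> show ?thesis
    by auto
qed

lemma norm_blaschke_factor_le_1:
  assumes "a \<noteq> 0" "cmod a < 1" "cmod z < 1"
  shows "cmod (blaschke_factor a z) \<le> 1"
proof -
  have "cmod (blaschke_factor a z) = cmod (Moebius_function 0 a z)"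
    using assms(1) norm_minus_commute[of a z]
    by (simp add: blaschke_factor_def Moebius_function_simple norm_mult norm_divide)
  then show ?thesis
    using Moebius_function_norm_lt_1[OF assms(2,3), of 0] by simp
qed

lemma schur_zero_of_minimal_modulus:
  assumes g: "schur g" "g 0 \<noteq> 0" and z: "cmod z < 1" "g z = 0"
  shows "\<exists>a. cmod a < 1 \<and> a \<noteq> 0 \<and> g a = 0 \<and> (\<forall>w. cmod w < cmod a \<longrightarrow> g w \<noteq> 0)"
proof -
  define K where "K = {w \<in> cball 0 (cmod z). g w = 0}"
  have "continuous_on (cball 0 (cmod z)) g"
    using g z by (auto simp: schur_def intro!: holomorphic_on_imp_continuous_on
        elim!: holomorphic_on_subset)
  then have "closed K"
    unfolding K_def by (intro continuous_closed_preimage_constant) auto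
  moreover have "bounded K"
    by (rule bounded_subset[OF bounded_cball[of 0 "cmod z"]]) (auto simp: K_def)
  ultimately have "compact K"
    by (simp add: compact_eq_bounded_closed)
  moreover have "z \<in> K"
    using z by (simp add: K_def)
  ultimately obtain a where a: "a \<in> K" "\<And>w. w \<in> K \<Longrightarrow> cmod a \<le> cmod w"
    using continuous_attains_inf[of K cmod] by (auto intro: continuous_intros)
  have "cmod a < 1" "g a = 0"
    using a(1) z by (auto simp: K_def)
  moreover have "a \<noteq> 0"
    using g \<open>g a = 0\<close> by auto
  moreover have "g w \<noteq> 0" if "cmod w < cmod a" for w
    using a(2)[of w] a(1) that by (auto simp: K_def)
  ultimately show ?thesis
    by blast
qed

text \<open>
  The zeros are removed one after another, in an order of non-decreasing modulus, until no zero is left; from then on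
  the sequence \<open>G\<close> is constant. A multiple zero is removed as often as its multiplicity says.
  Minimality of \<open>|a n|\<close> is what makes \<open>G n\<close> zero-free on the disk of radius \<open>|a n|\<close>.
\<close>

lemma schur_zero_extraction:
  assumes f: "schur f" "f 0 \<noteq> 0"
  shows "\<exists>G a. G 0 = f \<and> (\<forall>n. schur (G n) \<and> G n 0 \<noteq> 0 \<and>
    (if \<exists>z\<in>ball 0 1. G n z = 0
     then a n \<in> ball 0 1 \<and> a n \<noteq> 0 \<and> (\<forall>w. cmod w < cmod (a n) \<longrightarrow> G n w \<noteq> 0)
        \<and> (\<forall>z\<in>ball 0 1. G n z = blaschke_factor (a n) z * G (Suc n) z)
     else G (Suc n) = G n))"
proof -
  define step where "step g a h \<longleftrightarrow>
    (if \<exists>z\<in>ball 0 1. g z = 0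
     then a \<in> ball 0 1 \<and> a \<noteq> 0 \<and> (\<forall>w. cmod w < cmod a \<longrightarrow> g w \<noteq> 0)
        \<and> (\<forall>z\<in>ball 0 1. g z = blaschke_factor a z * h z)
     else h = g)" for g h :: "complex \<Rightarrow> complex" and a
  have "\<exists>G. \<forall>n. (schur (G n) \<and> G n 0 \<noteq> 0 \<and> (n = 0 \<longrightarrow> G n = f)) \<and> (\<exists>a. step (G n) a (G (Suc n)))"
  proof (rule dependent_nat_choice)
    show "\<exists>g. schur g \<and> g 0 \<noteq> 0 \<and> (0 = 0 \<longrightarrow> g = f)"
      using f by blast
    fix g :: "complex \<Rightarrow> complex" and n :: nat
    assume "schur g \<and> g 0 \<noteq> 0 \<and> (n = 0 \<longrightarrow> g = f)"
    then have g: "schur g" "g 0 \<noteq> 0"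
      by auto
    show "\<exists>h. (schur h \<and> h 0 \<noteq> 0 \<and> (Suc n = 0 \<longrightarrow> h = f)) \<and> (\<exists>a. step g a h)"
    proof (cases "\<exists>z\<in>ball 0 1. g z = 0")
      case True
      then obtain z where z: "cmod z < 1" "g z = 0"
        by auto
      obtain a where a: "cmod a < 1" "a \<noteq> 0" "g a = 0" "\<forall>w. cmod w < cmod a \<longrightarrow> g w \<noteq> 0"
        using schur_zero_of_minimal_modulus[OF g z] by blast
      obtain h where h: "schur h" "\<forall>z. cmod z < 1 \<longrightarrow> g z = blaschke_factor a z * h z"
        using schur_divide_blaschke_factor[OF g(1) a(2,1,3)] by blast
      have "h 0 \<noteq> 0"
        using h(2) g by auto
      moreover have "step g a h"
        using True a h by (simp add: step_def)
      ultimately show ?thesis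
        using h(1) by blast
    next
      case False
      then show ?thesis
        using g by (intro exI[of _ g]) (auto simp: step_def)
    qed
  qed
  then obtain G where G: "\<forall>n. (schur (G n) \<and> G n 0 \<noteq> 0 \<and> (n = 0 \<longrightarrow> G n = f))
      \<and> (\<exists>a. step (G n) a (G (Suc n)))"
    by blast
  then have "\<exists>a. \<forall>n. step (G n) (a n) (G (Suc n))"
    by (intro choice) blast
  then obtain a where a: "\<forall>n. step (G n) (a n) (G (Suc n))"
    by blast
  show ?thesis
  proof (intro exI conjI allI)
    show "G 0 = f" "schur (G n)" "G n 0 \<noteq> 0" for n
      using G by blast+
  qed (rule a[unfolded step_def, THEN spec])
qed

section \<open>A criterion for Blaschke products\<close>

text \<open>
  With \<open>f = z ^ m * f1\<close> and \<open>f1 = T 0 * ... * T (n - 1) * G n\<close>, where each \<open>T i\<close> is a Blaschke factor or 1, the task is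
  to show that \<open>G n\<close> tends to a unimodular constant. The bound \<open>|G n (0)| \<le> 1\<close> keeps the product of the \<open>|a i|\<close> away from 0, which is
  the Blaschke condition. It follows that \<open>|a n| \<rightarrow> 1\<close> if there are infinitely many zeros, so for any \<open>r < 1\<close>
  some \<open>G n\<close> is zero-free on a disk of radius greater than \<open>r\<close>. On it the mean value property and \<open>|f| \<le> |G n|\<close>
  bound \<open>- ln |G n (0)|\<close> by the circle mean of \<open>neg_log |f|\<close>. Hence \<open>|G n (0)|\<close> increases to 1, and since \<open>T i (0) > 0\<close>, the
  argument of \<open>G n (0)\<close> does not depend on \<open>n\<close>. So \<open>G n (0)\<close> converges, and \<open>G n (z)\<close> has the
  same limit by \<open>schur_dist_center_le\<close>.
\<close>

theorem is_blaschke_product_if_small_log_means: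
  assumes hol: "f holomorphic_on ball 0 1" and le1: "\<And>z. z \<in> ball 0 1 \<Longrightarrow> cmod (f z) \<le> 1"
    and small: "\<And>\<epsilon>. 0 < \<epsilon> \<Longrightarrow> \<exists>r. 0 < r \<and> r < 1 \<and>
      (\<integral>\<^sup>+t. neg_log (cmod (f (of_real r * cis t))) \<partial>uniform_angle) \<le> ennreal \<epsilon>"
  shows "is_blaschke_product f"
proof -
  interpret U: prob_space uniform_angle by (rule prob_space_uniform_angle)
  have schur_f: "schur f"
    using hol le1 by (simp add: schur_def)
  have "\<exists>z\<in>ball 0 1. f z \<noteq> 0"
  proof (rule ccontr)
    assume "\<not> ?thesis"
    then have zero: "f z = 0" if "cmod z < 1" for z
      using that by auto
    obtain r where r: "0 < r" "r < 1"
      "(\<integral>\<^sup>+t. neg_log (cmod (f (of_real r * cis t))) \<partial>uniform_angle) \<le> ennreal 1"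
      using small[of 1] by auto
    have "neg_log (cmod (f (of_real r * cis t))) = \<infinity>" for t
      using r by (subst zero) (auto simp: norm_mult neg_log_def)
    with r(3) show False
      by (simp add: U.emeasure_space_1 top_unique del: space_uniform_measure)
  qed
  then obtain z\<^sub>0 where z0: "cmod z\<^sub>0 < 1" "f z\<^sub>0 \<noteq> 0"
    by auto
  obtain m f1 where f1: "schur f1" "f1 0 \<noteq> 0" and f_eq: "\<And>z. cmod z < 1 \<Longrightarrow> f z = z ^ m * f1 z"
    using schur_factor_power[OF schur_f z0] by auto
  obtain G a where G0: "G 0 = f1" and G: "\<forall>n. schur (G n) \<and> G n 0 \<noteq> 0 \<and>
    (if \<exists>z\<in>ball 0 1. G n z = 0
     then a n \<in> ball 0 1 \<and> a n \<noteq> 0 \<and> (\<forall>w. cmod w < cmod (a n) \<longrightarrow> G n w \<noteq> 0)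
        \<and> (\<forall>z\<in>ball 0 1. G n z = blaschke_factor (a n) z * G (Suc n) z)
     else G (Suc n) = G n)"
    using schur_zero_extraction[OF f1] by blast
  have schur_G: "schur (G n)" and G_nz: "G n 0 \<noteq> 0" for n
    using G by blast+
  have step: "a n \<in> ball 0 1 \<and> a n \<noteq> 0 \<and> (\<forall>w. cmod w < cmod (a n) \<longrightarrow> G n w \<noteq> 0)
      \<and> (\<forall>z\<in>ball 0 1. G n z = blaschke_factor (a n) z * G (Suc n) z)"
    if "\<exists>z\<in>ball 0 1. G n z = 0" for n
    using G[THEN spec, of n] unfolding if_P[OF that] by blast
  have stop: "G (Suc n) = G n" if "\<not> (\<exists>z\<in>ball 0 1. G n z = 0)" for n
    using G[THEN spec, of n] unfolding if_not_P[OF that] by (elim conjE)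
  define act where "act n \<longleftrightarrow> (\<exists>z\<in>ball 0 1. G n z = 0)" for n
  \<comment> \<open>Active indices form an initial segment, since \<open>G\<close> stays constant once it has no zeros; \<open>N\<close> is its length.\<close>
  define N where "N = (if \<forall>n. act n then \<infinity> else enat (LEAST n. \<not> act n))"
  have act_iff: "act n \<longleftrightarrow> enat n < N" for n
  proof (cases "\<forall>n. act n")
    case False
    define L where "L = (LEAST n. \<not> act n)"
    have L: "\<not> act L"
      unfolding L_def using False by (rule LeastI_ex[of "\<lambda>n. \<not> act n", OF iffD1[OF not_all]])
    have "\<not> act n" if "L \<le> n"
      using that by (induction n rule: dec_induct) (use L stop in \<open>auto simp: act_def\<close>)
    moreover have "act n" if "n < L"
      using that not_less_Least unfolding L_def by blast
    ultimately have "act n \<longleftrightarrow> n < L"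
      using not_le by blast
    then show ?thesis
      unfolding N_def if_not_P[OF False] L_def[symmetric] by simp
  qed (simp add: N_def)
  have zeros: "a n \<in> ball 0 1" "a n \<noteq> 0" "\<forall>w. cmod w < cmod (a n) \<longrightarrow> G n w \<noteq> 0"
    "\<forall>z\<in>ball 0 1. G n z = blaschke_factor (a n) z * G (Suc n) z" if "act n" for n
    using step[OF that[unfolded act_def]] by blast+
  then have a: "cmod (a n) < 1" "a n \<noteq> 0" if "act n" for n
    using that by auto
  define T where "T n z = (if enat n < N \<and> a n \<noteq> 0 then blaschke_factor (a n) z else 1)" for n z
  have G_Suc: "G n z = T n z * G (Suc n) z" if "cmod z < 1" for n z
  proof (cases "act n")
    case True
    then have "T n z = blaschke_factor (a n) z"
      using a(2) by (simp add: T_def act_iff[symmetric])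
    moreover have "G n z = blaschke_factor (a n) z * G (Suc n) z"
      by (rule bspec[OF zeros(4)[OF True]]) (use that in simp)
    ultimately show ?thesis
      by (simp only:)
  next
    case False
    then have "T n z = 1"
      by (simp add: T_def act_iff[symmetric])
    then show ?thesis
      using stop False unfolding act_def by simp
  qed
  have f1_eq: "f1 z = (\<Prod>i<n. T i z) * G n z" if "cmod z < 1" for n z
  proof (induction n)
    case (Suc n)
    then have "f1 z = (\<Prod>i<n. T i z) * (T n z * G (Suc n) z)"
      by (simp only: G_Suc[OF that, of n])
    then show ?case
      by (simp add: mult.assoc)
  qed (simp add: G0)
  have T_le: "cmod (T n z) \<le> 1" if "cmod z < 1" for n z
    using norm_blaschke_factor_le_1[of "a n" z] a[of n] that by (auto simp: T_def act_iff)
  have f_le_G: "cmod (f z) \<le> cmod (G n z)" if "cmod z < 1" for n z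
  proof -
    have "cmod (z ^ m * (\<Prod>i<n. T i z)) \<le> 1"
      using that T_le by (auto simp: norm_mult norm_power prod_norm[symmetric]
          intro!: mult_le_one power_le_one prod_le_1 prod_nonneg)
    then have "cmod (z ^ m * (\<Prod>i<n. T i z)) * cmod (G n z) \<le> 1 * cmod (G n z)"
      by (intro mult_right_mono) auto
    then show ?thesis
      by (simp add: f_eq[OF that] f1_eq[OF that, of n] norm_mult mult.assoc)
  qed

  define d where "d n = (if enat n < N then 1 - cmod (a n) else 0)" for n
  have d_nonneg: "0 \<le> d n" for n
    using a(1)[of n] by (auto simp: d_def act_iff)
  \<comment> \<open>The factor \<open>|a| / a\<close> in a Blaschke factor makes its value at 0 equal to \<open>|a|\<close>.\<close>
  have T_0: "T n 0 = of_real (1 - d n)" for n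
    using a(2)[of n] by (auto simp: T_def d_def act_iff blaschke_factor_def)
  have d_less: "d n < 1" for n
    using a(2)[of n] by (auto simp: d_def act_iff)
  have "summable d"
  proof (rule summableI_nonneg_bounded)
    show "(\<Sum>i<n. d i) \<le> - ln (cmod (f1 0))" for n
    proof -
      have "cmod (T i 0) = 1 - d i" for i
        unfolding T_0 norm_of_real using d_less[of i] by simp
      moreover have "f1 0 = (\<Prod>i<n. T i 0) * G n 0"
        by (rule f1_eq) simp
      ultimately have "cmod (f1 0) = (\<Prod>i<n. 1 - d i) * cmod (G n 0)"
        by (simp only: norm_mult prod_norm[symmetric])
      also have "\<dots> \<le> (\<Prod>i<n. exp (- d i)) * 1"
      proof (rule mult_mono)
        show "(\<Prod>i<n. 1 - d i) \<le> (\<Prod>i<n. exp (- d i))"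
        proof (rule prod_mono)
          fix i show "0 \<le> 1 - d i \<and> 1 - d i \<le> exp (- d i)"
            using d_less[of i] exp_ge_add_one_self[of "- d i"] by simp
        qed
        show "cmod (G n 0) \<le> 1"
          using schur_G[of n] by (simp add: schur_def)
      qed (auto intro: prod_nonneg)
      finally have "cmod (f1 0) \<le> exp (- (\<Sum>i<n. d i))"
        by (simp add: exp_sum sum_negf flip: sum_negf)
      then have "ln (cmod (f1 0)) \<le> - (\<Sum>i<n. d i)"
        using f1(2) by (subst (asm) ln_le_cancel_iff[symmetric]) auto
      then show ?thesis
        by simp
    qed
  qed (rule d_nonneg)

  have exhaust: "\<exists>n R. r < R \<and> R \<le> 1 \<and> (\<forall>w\<in>ball 0 R. G n w \<noteq> 0)" if "r < 1" for r
  proof (cases "\<forall>n. act n")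
    case True
    have "d \<longlonglongrightarrow> 0"
      using \<open>summable d\<close> by (rule summable_LIMSEQ_zero)
    then have "eventually (\<lambda>n. d n < 1 - r) sequentially"
      using that by (intro order_tendstoD) auto
    then obtain n where "d n < 1 - r"
      by (auto simp: eventually_sequentially)
    then show ?thesis
      using True a(1)[of n] zeros(3)[of n]
      by (intro exI[of _ n] exI[of _ "cmod (a n)"]) (auto simp: d_def act_iff[symmetric])
  next
    case False
    then show ?thesis
      using that by (auto simp: act_def intro: exI[of _ 1])
  qed
  have G_center_le: "cmod (G n 0) \<le> 1" for n
    using schur_G[of n] by (simp add: schur_def)
  have "incseq (\<lambda>n. cmod (G n 0))"
  proof (rule incseq_SucI)
    fix n
    show "cmod (G n 0) \<le> cmod (G (Suc n) 0)"
      using T_le[of 0 n] by (simp add: G_Suc[of 0 n] norm_mult mult_left_le_one_le)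
  qed
  have G_center_ge: "\<exists>n. 1 - \<epsilon> \<le> cmod (G n 0)" if "0 < \<epsilon>" for \<epsilon>
  proof -
    obtain r where r: "0 < r" "r < 1"
      "(\<integral>\<^sup>+t. neg_log (cmod (f (of_real r * cis t))) \<partial>uniform_angle) \<le> ennreal \<epsilon>"
      using small[OF \<open>0 < \<epsilon>\<close>] by auto
    obtain n R where n: "r < R" "R \<le> 1" "\<And>w. w \<in> ball 0 R \<Longrightarrow> G n w \<noteq> 0"
      using exhaust[OF r(2)] by blast
    have circ: "of_real r * cis t \<in> ball 0 R" for t
      using r n by (simp add: norm_mult)
    have "G n holomorphic_on ball 0 R"
      using schur_G[of n] n(2) by (auto simp: schur_def elim!: holomorphic_on_subset)
    note mv = mean_value_ln_norm[OF this n(3) r(1) n(1)]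
    have nonneg: "0 \<le> - ln (cmod (G n (of_real r * cis t)))" for t
      using schur_G[of n] n(3)[OF circ] r by (simp add: schur_def norm_mult)
    have "ennreal (- ln (cmod (G n 0)))
        = ennreal (\<integral>t. - ln (cmod (G n (of_real r * cis t))) \<partial>uniform_angle)"
      using mv by simp
    also have "\<dots> = (\<integral>\<^sup>+t. ennreal (- ln (cmod (G n (of_real r * cis t)))) \<partial>uniform_angle)"
      using mv nonneg by (intro nn_integral_eq_integral[symmetric]) auto
    also have "\<dots> = (\<integral>\<^sup>+t. neg_log (cmod (G n (of_real r * cis t))) \<partial>uniform_angle)"
      using n(3)[OF circ] by (simp add: neg_log_def)
    also have "\<dots> \<le> (\<integral>\<^sup>+t. neg_log (cmod (f (of_real r * cis t))) \<partial>uniform_angle)"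
      using r by (intro nn_integral_mono neg_log_antimono f_le_G) (auto simp: norm_mult)
    also have "\<dots> \<le> ennreal \<epsilon>"
      by (rule r)
    finally have "- ln (cmod (G n 0)) \<le> \<epsilon>"
      using that by (simp add: ennreal_le_iff)
    then have "exp (- \<epsilon>) \<le> cmod (G n 0)"
      using G_nz[of n] by (simp add: ln_ge_iff flip: minus_le_iff)
    moreover have "1 - \<epsilon> \<le> exp (- \<epsilon>)"
      using exp_ge_add_one_self[of "- \<epsilon>"] by simp
    ultimately show ?thesis
      by (intro exI[of _ n]) linarith
  qed
  have center_lim: "(\<lambda>n. cmod (G n 0)) \<longlonglongrightarrow> 1"
  proof (rule increasing_LIMSEQ)
    show "cmod (G n 0) \<le> cmod (G (Suc n) 0)" for n
      using \<open>incseq _\<close> by (simp add: incseq_Suc_iff)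
    show "\<exists>n. 1 \<le> cmod (G n 0) + \<epsilon>" if "0 < \<epsilon>" for \<epsilon>
      using G_center_ge[OF that] by (simp add: algebra_simps)
  qed (rule G_center_le)

  define u where "u = f1 0 / of_real (cmod (f1 0))"
  have "cmod u = 1"
    using f1(2) by (simp add: u_def norm_divide)
  have G_center: "G n 0 = of_real (cmod (G n 0)) * u" for n
  proof -
    define p where "p = (\<Prod>i<n. 1 - d i)"
    have "0 < p"
      unfolding p_def using d_less by (intro prod_pos) auto
    moreover have "f1 0 = of_real p * G n 0"
      using f1_eq[of 0 n] by (simp add: T_0 p_def)
    ultimately show ?thesis
      using G_nz[of n] by (simp add: u_def norm_mult)
  qed
  have G_lim: "(\<lambda>n. G n z) \<longlonglongrightarrow> u" if z: "cmod z < 1" for z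
  proof -
    have "(\<lambda>n. of_real (cmod (G n 0)) * u) \<longlonglongrightarrow> of_real 1 * u"
      by (intro tendsto_intros center_lim)
    then have "(\<lambda>n. G n 0) \<longlonglongrightarrow> u"
      by (simp flip: G_center)
    moreover have "(\<lambda>n. G n z - G n 0) \<longlonglongrightarrow> 0"
    proof (rule Lim_null_comparison)
      show "eventually (\<lambda>n. norm (G n z - G n 0)
          \<le> (1 - (cmod (G n 0))\<^sup>2) * (cmod z / (1 - cmod z))) sequentially"
        using schur_dist_center_le[OF schur_G z] by simp
      have "(\<lambda>n. (1 - (cmod (G n 0))\<^sup>2) * (cmod z / (1 - cmod z)))
          \<longlonglongrightarrow> (1 - 1\<^sup>2) * (cmod z / (1 - cmod z))"
        by (intro tendsto_mult tendsto_diff tendsto_power tendsto_const center_lim)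
      then show "(\<lambda>n. (1 - (cmod (G n 0))\<^sup>2) * (cmod z / (1 - cmod z))) \<longlonglongrightarrow> 0"
        by simp
    qed
    ultimately have "(\<lambda>n. G n 0 + (G n z - G n 0)) \<longlonglongrightarrow> u + 0"
      by (rule tendsto_add)
    then show ?thesis
      by simp
  qed
  have a_ball: "\<forall>n. enat n < N \<longrightarrow> a n \<in> ball 0 1"
    using a(1) by (simp add: act_iff)
  have blaschke: "f z = blaschke (Arg u) m N a z" if z: "z \<in> ball 0 1" for z
  proof -
    have z': "cmod z < 1"
      using z by simp
    have "convergent_prod (\<lambda>n. T n z)"
      unfolding T_def using a_ball \<open>summable d\<close>[unfolded d_def] z by (rule convergent_prod_blaschke)
    then have "(\<lambda>n. \<Prod>i\<le>n. T i z) \<longlonglongrightarrow> (\<Prod>n. T n z)"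
      by (rule convergent_prod_LIMSEQ)
    then have "(\<lambda>n. (\<Prod>i\<le>n. T i z) * G (Suc n) z) \<longlonglongrightarrow> (\<Prod>n. T n z) * u"
      using LIMSEQ_Suc[OF G_lim[OF z']] by (rule tendsto_mult)
    moreover have "(\<lambda>n. (\<Prod>i\<le>n. T i z) * G (Suc n) z) = (\<lambda>n. f1 z)"
    proof
      show "(\<Prod>i\<le>n. T i z) * G (Suc n) z = f1 z" for n
        using f1_eq[OF z', of "Suc n"] by (simp only: lessThan_Suc_atMost)
    qed
    ultimately have "f1 z = (\<Prod>n. T n z) * u"
      by (metis LIMSEQ_const_iff)
    moreover have "u = of_real (cmod u) * exp (\<i> * of_real (Arg u))"
      using \<open>cmod u = 1\<close> by (intro Arg_eq) auto
    then have "exp (\<i> * of_real (Arg u)) = u"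
      by (metis \<open>cmod u = 1\<close> mult_1 of_real_1)
    ultimately show ?thesis
      unfolding blaschke_def T_def[symmetric] by (simp add: f_eq[OF z'] mult_ac)
  qed
  show ?thesis
    unfolding is_blaschke_product_def
  proof (intro exI conjI)
    show "summable (\<lambda>n. if enat n < N then 1 - cmod (a n) else 0)"
      using \<open>summable d\<close> by (simp add: d_def[abs_def])
  qed (use a_ball blaschke in auto)
qed

section \<open>Herglotz integrals of purely atomic measures\<close>

definition herglotz_sum :: "(nat \<Rightarrow> real) \<Rightarrow> (nat \<Rightarrow> complex) \<Rightarrow> complex \<Rightarrow> complex" where
  "herglotz_sum c \<zeta> z = (\<Sum>n. of_real (c n) * ((\<zeta> n + z) / (\<zeta> n - z)))"

lemma norm_herglotz_kernel_le:
  assumes "cmod \<zeta> = 1" "cmod z < 1"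
  shows "cmod ((\<zeta> + z) / (\<zeta> - z)) \<le> 2 / (1 - cmod z)"
proof -
  have "1 - cmod z \<le> cmod (\<zeta> - z)"
    using norm_triangle_ineq2[of \<zeta> z] assms by simp
  moreover have "cmod (\<zeta> + z) \<le> 2"
    using norm_triangle_ineq[of \<zeta> z] assms by simp
  ultimately show ?thesis
    unfolding norm_divide using assms by (intro frac_le) auto
qed

text \<open>
  This form of the measure turns integrals into series by the transformation rule.
\<close>

lemma atomic_measure_eq_distr:
  assumes "\<And>n. cmod (\<zeta> n) = 1"
  shows "atomic_measure c \<zeta> =
    distr (density (count_space UNIV) (\<lambda>n. ennreal (c n))) circle_algebra \<zeta>"
proof (rule measure_eqI)
  fix A assume "A \<in> sets (atomic_measure c \<zeta>)"
  then have A: "A \<in> sets circle_algebra"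
    by simp
  have \<zeta>: "\<zeta> \<in> measurable (density (count_space UNIV) (\<lambda>n. ennreal (c n))) circle_algebra"
    using assms by (auto simp: measurable_def space_restrict_space)
  have "emeasure (distr (density (count_space UNIV) (\<lambda>n. ennreal (c n))) circle_algebra \<zeta>) A
      = (\<integral>\<^sup>+n. ennreal (c n) * indicator (\<zeta> -` A) n \<partial>count_space UNIV)"
    by (simp add: emeasure_distr[OF \<zeta> A] emeasure_density)
  also have "\<dots> = (\<Sum>n. ennreal (c n) * indicator A (\<zeta> n))"
    by (simp add: nn_integral_count_space_nat indicator_def)
  finally show "emeasure (atomic_measure c \<zeta>) A =
      emeasure (distr (density (count_space UNIV) (\<lambda>n. ennreal (c n))) circle_algebra \<zeta>) A"
    by (simp add: emeasure_atomic_measure[OF A])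
qed simp

lemma ennreal_min_1_sum_le:
  assumes x: "\<And>n. 0 \<le> x n" and sums: "x sums (s::real)"
  shows "ennreal (min 1 s) \<le> (\<Sum>n. ennreal (min 1 (x n)))"
proof (cases "\<exists>n. 1 \<le> x n")
  case True
  then obtain n where "1 \<le> x n" ..
  then have "ennreal (min 1 s) \<le> ennreal (min 1 (x n))"
    by (intro ennreal_leI) auto
  also have "\<dots> \<le> (\<Sum>n. ennreal (min 1 (x n)))"
    using sum_le_suminf[of "\<lambda>n. ennreal (min 1 (x n))" "{n}"] by simp
  finally show ?thesis .
next
  case False
  then have "min 1 (x n) = x n" for n
    by (metis linear min_absorb2)
  then have "(\<Sum>n. ennreal (min 1 (x n))) = (\<Sum>n. ennreal (x n))"
    by simp
  also have "\<dots> = ennreal s"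
    using x sums by (simp add: suminf_ennreal2 sums_iff)
  finally show ?thesis
    by (simp add: ennreal_leI)
qed

text \<open>
  Summable weights, instead of weights with sum 1, keep the locale closed under the removal of an atom.
\<close>

locale circle_atoms =
  fixes c :: "nat \<Rightarrow> real" and \<zeta> :: "nat \<Rightarrow> complex"
  assumes c_nonneg: "0 \<le> c n" and c_summable: "summable c" and \<zeta>_circle: "cmod (\<zeta> n) = 1"
begin

lemma summable_norm_herglotz_terms:
  assumes "cmod z < 1"
  shows "summable (\<lambda>n. cmod (of_real (c n) * ((\<zeta> n + z) / (\<zeta> n - z))))"
proof (rule summable_comparison_test')
  show "summable (\<lambda>n. c n * (2 / (1 - cmod z)))"
    by (rule summable_mult2[OF c_summable])
  show "norm (cmod (of_real (c n) * ((\<zeta> n + z) / (\<zeta> n - z)))) \<le> c n * (2 / (1 - cmod z))" for n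
    unfolding real_norm_def abs_norm_cancel
    unfolding norm_mult norm_of_real abs_of_nonneg[OF c_nonneg]
    by (intro mult_left_mono norm_herglotz_kernel_le \<zeta>_circle assms c_nonneg)
qed

lemma herglotz_atomic_measure:
  assumes "cmod z < 1"
  shows "herglotz (atomic_measure c \<zeta>) z = herglotz_sum c \<zeta> z"
proof -
  have \<zeta>: "\<zeta> \<in> measurable (density (count_space UNIV) (\<lambda>n. ennreal (c n))) circle_algebra"
    using \<zeta>_circle by (auto simp: measurable_def space_restrict_space)
  have "herglotz (atomic_measure c \<zeta>) z
      = (\<integral>n. (\<zeta> n + z) / (\<zeta> n - z) \<partial>density (count_space UNIV) (\<lambda>n. ennreal (c n)))"
    unfolding herglotz_def atomic_measure_eq_distr[OF \<zeta>_circle]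
    by (rule integral_distr[OF \<zeta>]) (intro measurable_restrict_space1, measurable)
  also have "\<dots> = (\<integral>n. of_real (c n) * ((\<zeta> n + z) / (\<zeta> n - z)) \<partial>count_space UNIV)"
    by (subst integral_density) (auto simp: c_nonneg scaleR_conv_of_real)
  also have "\<dots> = herglotz_sum c \<zeta> z"
    unfolding herglotz_sum_def
    by (rule integral_count_space_nat)
      (simp only: integrable_count_space_nat_iff summable_norm_herglotz_terms[OF assms])
  finally show ?thesis .
qed

text \<open>
  On a closed disk inside the unit disk the kernels are uniformly bounded, so the series converges uniformly by the
  Weierstrass test.
\<close>

lemma herglotz_sum_holomorphic: "herglotz_sum c \<zeta> holomorphic_on ball 0 1"
proof (rule holomorphic_uniform_sequence)
  show "(\<lambda>z. \<Sum>i<n. of_real (c i) * ((\<zeta> i + z) / (\<zeta> i - z))) holomorphic_on ball 0 1" for n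
    using \<zeta>_circle by (intro holomorphic_intros) (auto simp: dist_norm)
  fix x :: complex assume x: "x \<in> ball 0 1"
  define d where "d = (1 - cmod x) / 2"
  have "0 < d"
    using x by (simp add: d_def)
  have le: "cmod z \<le> 1 - d" if "z \<in> cball x d" for z
    using that norm_triangle_sub[of z x] by (simp add: d_def dist_norm norm_minus_commute field_simps)
  have "cball x d \<subseteq> ball 0 1"
    using le \<open>0 < d\<close> by force
  moreover have "uniform_limit (cball x d)
      (\<lambda>n z. \<Sum>i<n. of_real (c i) * ((\<zeta> i + z) / (\<zeta> i - z))) (herglotz_sum c \<zeta>) sequentially"
    unfolding herglotz_sum_def
  proof (rule Weierstrass_m_test)
    show "summable (\<lambda>n. c n * (2 / d))"
      by (rule summable_mult2[OF c_summable])
    fix n z assume z: "z \<in> cball x d"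
    have "cmod ((\<zeta> n + z) / (\<zeta> n - z)) \<le> 2 / (1 - cmod z)"
      using le[OF z] \<open>0 < d\<close> by (intro norm_herglotz_kernel_le \<zeta>_circle) auto
    also have "\<dots> \<le> 2 / d"
      using le[OF z] \<open>0 < d\<close> by (intro divide_left_mono) auto
    finally show "cmod (of_real (c n) * ((\<zeta> n + z) / (\<zeta> n - z))) \<le> c n * (2 / d)"
      unfolding norm_mult norm_of_real abs_of_nonneg[OF c_nonneg]
      by (intro mult_left_mono c_nonneg)
  qed
  ultimately show "\<exists>d>0. cball x d \<subseteq> ball 0 1 \<and> uniform_limit (cball x d)
      (\<lambda>n z. \<Sum>i<n. of_real (c i) * ((\<zeta> i + z) / (\<zeta> i - z))) (herglotz_sum c \<zeta>) sequentially"
    using \<open>0 < d\<close> by blast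
qed simp

lemma Re_herglotz_sum:
  assumes "cmod z < 1"
  shows "(\<lambda>n. c n * Re ((\<zeta> n + z) / (\<zeta> n - z))) sums Re (herglotz_sum c \<zeta> z)"
proof -
  have "(\<lambda>n. of_real (c n) * ((\<zeta> n + z) / (\<zeta> n - z))) sums herglotz_sum c \<zeta> z"
    unfolding herglotz_sum_def
    by (rule summable_sums[OF summable_norm_cancel[OF summable_norm_herglotz_terms[OF assms]]])
  then have "(\<lambda>n. Re (of_real (c n) * ((\<zeta> n + z) / (\<zeta> n - z)))) sums Re (herglotz_sum c \<zeta> z)"
    by (rule sums_Re)
  then show ?thesis
    by (simp del: times_divide_eq_right)
qed

lemma Re_herglotz_term_nonneg:
  assumes "cmod z < 1"
  shows "0 \<le> c n * Re ((\<zeta> n + z) / (\<zeta> n - z))"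
  by (intro mult_nonneg_nonneg c_nonneg Re_herglotz_kernel_nonneg \<zeta>_circle assms)

lemma Re_herglotz_sum_nonneg:
  assumes "cmod z < 1"
  shows "0 \<le> Re (herglotz_sum c \<zeta> z)"
  using Re_herglotz_term_nonneg[OF assms] sums_le[OF _ sums_zero Re_herglotz_sum[OF assms]] by blast

lemma circle_atoms_drop: "circle_atoms (c(k := 0)) \<zeta>"
proof
  show "summable (c(k := 0))"
    by (rule summable_comparison_test'[OF c_summable]) (simp add: c_nonneg)
qed (simp_all add: c_nonneg \<zeta>_circle)

lemma herglotz_sum_split:
  assumes "cmod z < 1"
  shows "herglotz_sum c \<zeta> z
    = of_real (c k) * ((\<zeta> k + z) / (\<zeta> k - z)) + herglotz_sum (c(k := 0)) \<zeta> z"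
proof -
  interpret drop: circle_atoms "c(k := 0)" \<zeta>
    by (rule circle_atoms_drop)
  define t where "t n = of_real (c n) * ((\<zeta> n + z) / (\<zeta> n - z))" for n
  define t' where "t' n = of_real ((c(k := 0)) n) * ((\<zeta> n + z) / (\<zeta> n - z))" for n
  have "(\<lambda>n. if n = k then t k else 0) sums t k"
    using sums_single[of k "\<lambda>_. t k"] by simp
  moreover have "t' sums herglotz_sum (c(k := 0)) \<zeta> z"
    unfolding herglotz_sum_def t'_def[abs_def]
    by (rule summable_sums[OF summable_norm_cancel[OF drop.summable_norm_herglotz_terms[OF assms]]])
  ultimately have "(\<lambda>n. (if n = k then t k else 0) + t' n) sums (t k + herglotz_sum (c(k := 0)) \<zeta> z)"
    by (rule sums_add)
  moreover have "(\<lambda>n. (if n = k then t k else 0) + t' n) = t"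
    by (auto simp: t_def t'_def)
  ultimately have "t sums (t k + herglotz_sum (c(k := 0)) \<zeta> z)"
    by simp
  then show ?thesis
    by (simp add: herglotz_sum_def t_def[abs_def] sums_unique[symmetric])
qed

text \<open>
  As \<open>min 1\<close> is subadditive, it suffices to bound the sum of the means \<open>p n j\<close> that belong to the single atoms. For a fixed
  atom, the Poisson kernel tends to 0 off the atom as \<open>r j \<rightarrow> 1\<close>, so \<open>p n j \<rightarrow> 0\<close> by bounded convergence. The
  Poisson kernel has mean 1, so \<open>p n j \<le> c n\<close>, and Tannery's theorem allows the exchange of the limit with the sum.
\<close>

lemma mean_min_1_Re_herglotz_sum_tendsto_0:
  assumes r: "\<And>j. 0 < r j" "\<And>j. r j < 1" and r_lim: "r \<longlonglongrightarrow> 1"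
  shows "(\<lambda>j. \<integral>\<^sup>+t. ennreal (min 1 (Re (herglotz_sum c \<zeta> (of_real (r j) * cis t)))) \<partial>uniform_angle)
    \<longlonglongrightarrow> 0"
proof -
  interpret U: prob_space uniform_angle by (rule prob_space_uniform_angle)
  have circ: "cmod (of_real (r j) * cis t) < 1" for j t
    using r[of j] by (simp add: norm_mult)
  define x where "x n j t = c n * Re ((\<zeta> n + of_real (r j) * cis t) / (\<zeta> n - of_real (r j) * cis t))" for n j t
  have x_nonneg: "0 \<le> x n j t" for n j t
    unfolding x_def by (rule Re_herglotz_term_nonneg[OF circ])
  have [measurable]: "x n j \<in> borel_measurable borel" for n j
    unfolding x_def[abs_def] by measurable
  have int: "integrable uniform_angle (\<lambda>t. min 1 (x n j t))" for n j
    by (rule U.integrable_const_bound[where B = 1]) (auto simp: x_nonneg abs_le_iff min_def intro: order_trans[OF _ x_nonneg])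
  define p where "p n j = (\<integral>t. min 1 (x n j t) \<partial>uniform_angle)" for n j
  have p_nonneg: "0 \<le> p n j" for n j
    unfolding p_def by (rule integral_nonneg_AE) (simp add: x_nonneg)
  have p_le: "p n j \<le> c n" for n j
  proof -
    have hol: "(\<lambda>z. (\<zeta> n + z) / (\<zeta> n - z)) holomorphic_on ball 0 1"
      using \<zeta>_circle by (intro holomorphic_intros) (auto simp: dist_norm)
    note mv = mean_value_circle[OF hol r]
    have int_x: "integrable uniform_angle (x n j)"
      unfolding x_def[abs_def] by (intro integrable_mult_right integrable_Re mv(1))
    have "p n j \<le> (\<integral>t. x n j t \<partial>uniform_angle)"
      unfolding p_def by (rule integral_mono[OF int int_x]) simp
    also have "\<dots> = c n * Re ((\<zeta> n + 0) / (\<zeta> n - 0))"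
      unfolding x_def[abs_def] using mv by (simp only: integral_mult_right_zero integral_Re)
    also have "\<dots> = c n"
      using \<zeta>_circle[of n] by (cases "\<zeta> n = 0") auto
    finally show ?thesis .
  qed
  have p_lim: "p n \<longlonglongrightarrow> 0" for n
  proof -
    have "(\<lambda>j. \<integral>t. min 1 (x n j t) \<partial>uniform_angle) \<longlonglongrightarrow> (\<integral>t. 0 \<partial>uniform_angle)"
    proof (rule integral_dominated_convergence[where w = "\<lambda>_. 1"])
      have "AE t in uniform_angle. \<zeta> n + (-1) * cis t \<noteq> 0"
        by (rule AE_uniform_angle_linear_nonzero) simp
      then show "AE t in uniform_angle. (\<lambda>j. min 1 (x n j t)) \<longlonglongrightarrow> 0"
      proof eventually_elim
        case (elim t)
        have "(\<lambda>j. c n * ((1 - (r j)\<^sup>2) / (cmod (\<zeta> n - of_real (r j) * cis t))\<^sup>2))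
            \<longlonglongrightarrow> c n * ((1 - 1\<^sup>2) / (cmod (\<zeta> n - of_real 1 * cis t))\<^sup>2)"
          using elim by (intro tendsto_intros r_lim) auto
        moreover have "x n j t = c n * ((1 - (r j)\<^sup>2) / (cmod (\<zeta> n - of_real (r j) * cis t))\<^sup>2)" for j
          unfolding x_def Re_herglotz_kernel[OF \<zeta>_circle circ] using r[of j] by (simp add: norm_mult)
        ultimately have "(\<lambda>j. x n j t) \<longlonglongrightarrow> 0"
          by simp
        then have "(\<lambda>j. min 1 (x n j t)) \<longlonglongrightarrow> min 1 0"
          by (intro tendsto_min tendsto_const)
        then show ?case
          by simp
      qed
    qed (auto simp: x_nonneg abs_le_iff intro!: AE_I2 intro: order_trans[OF _ x_nonneg])
    then show ?thesis
      by (simp add: p_def[abs_def])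
  qed
  have p_summable: "summable (\<lambda>n. p n j)" for j
    by (rule summable_comparison_test'[OF c_summable]) (simp add: p_nonneg p_le)
  have "(\<lambda>j. \<Sum>n. p n j) \<longlonglongrightarrow> (\<Sum>n. 0)"
    by (rule tannerys_theorem[THEN conjunct2, THEN conjunct2, OF p_lim _ c_summable])
      (auto intro!: always_eventually simp: p_nonneg p_le)
  then have lim: "(\<lambda>j. ennreal (\<Sum>n. p n j)) \<longlonglongrightarrow> 0"
    using tendsto_ennrealI by fastforce
  have "(\<integral>\<^sup>+t. ennreal (min 1 (Re (herglotz_sum c \<zeta> (of_real (r j) * cis t)))) \<partial>uniform_angle)
      \<le> ennreal (\<Sum>n. p n j)" for j
  proof -
    have "(\<integral>\<^sup>+t. ennreal (min 1 (Re (herglotz_sum c \<zeta> (of_real (r j) * cis t)))) \<partial>uniform_angle)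
        \<le> (\<integral>\<^sup>+t. (\<Sum>n. ennreal (min 1 (x n j t))) \<partial>uniform_angle)"
      by (intro nn_integral_mono ennreal_min_1_sum_le x_nonneg)
        (simp only: x_def Re_herglotz_sum[OF circ])
    also have "\<dots> = (\<Sum>n. \<integral>\<^sup>+t. ennreal (min 1 (x n j t)) \<partial>uniform_angle)"
      by (rule nn_integral_suminf) simp
    also have "\<dots> = (\<Sum>n. ennreal (p n j))"
      unfolding p_def by (intro suminf_cong nn_integral_eq_integral int) (simp add: x_nonneg)
    also have "\<dots> = ennreal (\<Sum>n. p n j)"
      by (rule suminf_ennreal2[OF p_nonneg p_summable])
    finally show ?thesis .
  qed
  then show ?thesis
    by (intro tendsto_sandwich[OF _ _ tendsto_const lim]) auto
qed

lemma associated_inner_atomic_measure: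
  assumes "cmod z < 1"
  shows "associated_inner (atomic_measure c \<zeta>) z
    = (herglotz_sum c \<zeta> z - 1) / (herglotz_sum c \<zeta> z + 1)"
  by (simp add: associated_inner_def herglotz_atomic_measure[OF assms])

lemma herglotz_sum_plus_1_nonzero:
  assumes "cmod z < 1"
  shows "herglotz_sum c \<zeta> z + 1 \<noteq> 0"
proof
  assume "herglotz_sum c \<zeta> z + 1 = 0"
  then have "Re (herglotz_sum c \<zeta> z + 1) = 0"
    by simp
  then show False
    using Re_herglotz_sum_nonneg[OF assms] by simp
qed

lemma associated_inner_holomorphic:
  "associated_inner (atomic_measure c \<zeta>) holomorphic_on ball 0 1"
proof (rule holomorphic_transform)
  show "(\<lambda>z. (herglotz_sum c \<zeta> z - 1) / (herglotz_sum c \<zeta> z + 1)) holomorphic_on ball 0 1"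
    by (intro holomorphic_intros herglotz_sum_holomorphic) (simp add: herglotz_sum_plus_1_nonzero)
qed (simp add: associated_inner_atomic_measure)

lemma norm_associated_inner_le_1:
  assumes "cmod z < 1"
  shows "cmod (associated_inner (atomic_measure c \<zeta>) z) \<le> 1"
  unfolding associated_inner_atomic_measure[OF assms] norm_divide
  using cmod_minus_1_le_plus_1[OF Re_herglotz_sum_nonneg[OF assms]]
  by (simp add: divide_le_eq_1)

end

section \<open>Averaging over the random atoms\<close>

lemma herglotz_sum_measurable [measurable]:
  assumes [measurable]: "\<And>n. X n \<in> borel_measurable N" "Y \<in> borel_measurable N"
  shows "(\<lambda>x. herglotz_sum c (\<lambda>n. cis (X n x)) (Y x)) \<in> borel_measurable N"
  unfolding herglotz_sum_def by measurable

text \<open>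
  The contribution \<open>Z\<close> of the atoms with index other than \<open>k\<close> is a function of the angles other than \<open>\<theta> k\<close>, hence
  independent of \<open>cis (\<theta> k)\<close>. The expectation is therefore an iterated integral, whose inner integral over the \<open>k\<close>-th atom is
  estimated by \<open>mean_neg_log_one_atom\<close>.
\<close>

lemma expectation_neg_log_le:
  assumes M: "prob_space M" and c: "\<And>n. 0 \<le> c n" "summable c" and k: "0 < c k" "c k \<le> 1"
    and indep: "prob_space.indep_vars M (\<lambda>_. borel) \<theta> UNIV"
    and unif: "distr M borel (\<theta> k) = uniform_angle"
    and z: "1/2 \<le> cmod z" "cmod z < 1"
  shows "(\<integral>\<^sup>+\<omega>. neg_log (cmod ((herglotz_sum c (\<lambda>n. cis (\<theta> n \<omega>)) z - 1)
            / (herglotz_sum c (\<lambda>n. cis (\<theta> n \<omega>)) z + 1))) \<partial>M)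
    \<le> (\<integral>\<^sup>+\<omega>. ennreal (- ln (cmod z)
          + 4 / (c k)\<^sup>2 * min 1 (Re (herglotz_sum (c(k := 0)) (\<lambda>n. cis (\<theta> n \<omega>)) z))) \<partial>M)"
proof -
  interpret prob_space M by (rule M)
  interpret U: prob_space uniform_angle by (rule prob_space_uniform_angle)
  have [measurable]: "\<theta> n \<in> borel_measurable M" for n
    using indep by (auto simp: indep_vars_def)
  define Z where "Z \<omega> = herglotz_sum (c(k := 0)) (\<lambda>n. cis (\<theta> n \<omega>)) z" for \<omega>
  have [measurable]: "Z \<in> borel_measurable M"
    unfolding Z_def by measurable
  define W where "W \<omega> = cis (\<theta> k \<omega>)" for \<omega>
  have [measurable]: "W \<in> borel_measurable M"
    unfolding W_def by measurable
  define F :: "(nat \<Rightarrow> real) \<Rightarrow> complex" where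
    "F x = (\<Sum>n. if n = k then 0 else of_real (c n) * ((cis (x n) + z) / (cis (x n) - z)))" for x
  have F: "F \<in> borel_measurable (PiM (- {k}) (\<lambda>_. borel))"
    unfolding F_def
  proof (rule borel_measurable_suminf)
    fix n
    show "(\<lambda>x. if n = k then 0 else of_real (c n) * ((cis (x n) + z) / (cis (x n) - z)))
        \<in> borel_measurable (PiM (- {k}) (\<lambda>_. borel))"
    proof (cases "n = k")
      case False
      then have [measurable]: "(\<lambda>x. x n) \<in> borel_measurable (PiM (- {k}) (\<lambda>_. borel :: real measure))"
        by (intro measurable_component_singleton) simp
      show ?thesis
        using False by simp
    qed simp
  qed
  have Z_eq: "Z \<omega> = F (restrict (\<lambda>n. \<theta> n \<omega>) (- {k}))" for \<omega>
    unfolding Z_def F_def herglotz_sum_def by (intro suminf_cong) simp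
  have "indep_var (PiM {k} (\<lambda>_. borel)) (\<lambda>\<omega>. restrict (\<lambda>n. \<theta> n \<omega>) {k})
      (PiM (- {k}) (\<lambda>_. borel)) (\<lambda>\<omega>. restrict (\<lambda>n. \<theta> n \<omega>) (- {k}))"
    by (rule indep_var_restrict[OF indep]) auto
  then have "indep_var borel ((\<lambda>x. cis (x k)) \<circ> (\<lambda>\<omega>. restrict (\<lambda>n. \<theta> n \<omega>) {k}))
      borel (F \<circ> (\<lambda>\<omega>. restrict (\<lambda>n. \<theta> n \<omega>) (- {k})))"
  proof (rule indep_var_compose)
    have [measurable]: "(\<lambda>x. x k) \<in> borel_measurable (PiM {k} (\<lambda>_. borel :: real measure))"
      by (intro measurable_component_singleton) simp
    show "(\<lambda>x. cis (x k)) \<in> borel_measurable (PiM {k} (\<lambda>_. borel))"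
      by measurable
  qed (rule F)
  moreover have "(\<lambda>x. cis (x k)) \<circ> (\<lambda>\<omega>. restrict (\<lambda>n. \<theta> n \<omega>) {k}) = W"
    "F \<circ> (\<lambda>\<omega>. restrict (\<lambda>n. \<theta> n \<omega>) (- {k})) = Z"
    by (auto simp: Z_eq W_def)
  ultimately have "indep_var borel W borel Z"
    by (simp only:)
  then have joint: "distr M borel W \<Otimes>\<^sub>M distr M borel Z = distr M (borel \<Otimes>\<^sub>M borel) (\<lambda>\<omega>. (W \<omega>, Z \<omega>))"
    unfolding indep_var_distribution_eq by blast
  interpret Wlaw: prob_space "distr M borel W"
    by (rule prob_space_distr) simp
  interpret Zlaw: prob_space "distr M borel Z"
    by (rule prob_space_distr) simp
  interpret pair_sigma_finite "distr M borel W" "distr M borel Z" ..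
  define g where "g p = neg_log (cmod ((of_real (c k) * ((fst p + z) / (fst p - z)) + snd p - 1)
      / (of_real (c k) * ((fst p + z) / (fst p - z)) + snd p + 1)))" for p :: "complex \<times> complex"
  have g_meas [measurable]: "g \<in> borel_measurable (borel \<Otimes>\<^sub>M borel)"
    unfolding g_def[abs_def] by measurable
  have W_law: "(\<integral>\<^sup>+w. g (w, y) \<partial>distr M borel W) = (\<integral>\<^sup>+t. g (cis t, y) \<partial>uniform_angle)" for y
  proof -
    have "(\<integral>\<^sup>+w. g (w, y) \<partial>distr M borel W) = (\<integral>\<^sup>+\<omega>. g (W \<omega>, y) \<partial>M)"
      by (rule nn_integral_distr) simp_all
    also have "\<dots> = (\<integral>\<^sup>+t. g (cis t, y) \<partial>distr M borel (\<theta> k))"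
      unfolding W_def by (rule nn_integral_distr[symmetric]) simp_all
    finally show ?thesis
      by (simp only: unif)
  qed
  have atoms: "circle_atoms c (\<lambda>n. cis (\<theta> n \<omega>))" for \<omega>
    by standard (simp_all add: c)
  have "(\<integral>\<^sup>+\<omega>. neg_log (cmod ((herglotz_sum c (\<lambda>n. cis (\<theta> n \<omega>)) z - 1)
      / (herglotz_sum c (\<lambda>n. cis (\<theta> n \<omega>)) z + 1))) \<partial>M) = (\<integral>\<^sup>+\<omega>. g (W \<omega>, Z \<omega>) \<partial>M)"
    by (simp only: circle_atoms.herglotz_sum_split[OF atoms z(2), of _ k] g_def Z_def W_def fst_conv snd_conv)
  also have "\<dots> = (\<integral>\<^sup>+p. g p \<partial>(distr M borel W \<Otimes>\<^sub>M distr M borel Z))"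
    unfolding joint by (subst nn_integral_distr) simp_all
  also have "\<dots> = (\<integral>\<^sup>+y. \<integral>\<^sup>+w. g (w, y) \<partial>distr M borel W \<partial>distr M borel Z)"
  proof (rule nn_integral_snd[symmetric])
    have "sets (distr M borel W \<Otimes>\<^sub>M distr M borel Z) = sets (borel \<Otimes>\<^sub>M borel)"
      by (intro sets_pair_measure_cong) simp_all
    then show "g \<in> borel_measurable (distr M borel W \<Otimes>\<^sub>M distr M borel Z)"
      by (subst measurable_cong_sets[OF _ refl]) (auto simp: g_meas)
  qed
  also have "\<dots> = (\<integral>\<^sup>+\<omega>. \<integral>\<^sup>+w. g (w, Z \<omega>) \<partial>distr M borel W \<partial>M)"
    by (rule nn_integral_distr) simp_all
  also have "\<dots> = (\<integral>\<^sup>+\<omega>. \<integral>\<^sup>+t. g (cis t, Z \<omega>) \<partial>uniform_angle \<partial>M)"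
    by (simp only: W_law)
  also have "\<dots> \<le> (\<integral>\<^sup>+\<omega>. ennreal (- ln (cmod z) + 4 / (c k)\<^sup>2 * min 1 (Re (Z \<omega>))) \<partial>M)"
  proof (rule nn_integral_mono)
    fix \<omega>
    have "0 \<le> Re (Z \<omega>)"
      unfolding Z_def
      by (rule circle_atoms.Re_herglotz_sum_nonneg[OF circle_atoms.circle_atoms_drop[OF atoms] z(2)])
    from mean_neg_log_one_atom[OF k this z]
    show "(\<integral>\<^sup>+t. g (cis t, Z \<omega>) \<partial>uniform_angle)
        \<le> ennreal (- ln (cmod z) + 4 / (c k)\<^sup>2 * min 1 (Re (Z \<omega>)))"
      by (simp only: g_def fst_conv snd_conv)
  qed
  finally show ?thesis
    unfolding Z_def .
qed

theorem theorem1p1: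
  fixes M :: "'a measure" and c :: "nat \<Rightarrow> real" and \<theta> :: "nat \<Rightarrow> 'a \<Rightarrow> real"
  assumes "prob_space M"
    and "\<And>n. c n \<ge> 0"
    and "c sums 1"
    and "prob_space.indep_vars M (\<lambda>_. borel) \<theta> UNIV"
    and "\<And>n. distr M borel (\<theta> n) = uniform_measure lborel {0..<2 * pi}"
  shows "AE \<omega> in M. is_blaschke_product
           (associated_inner (atomic_measure c (\<lambda>n. exp (\<i> * of_real (\<theta> n \<omega>)))))"
proof -
  interpret prob_space M by (rule assms(1))
  interpret U: prob_space uniform_angle by (rule prob_space_uniform_angle)
  interpret MU: pair_sigma_finite M uniform_angle ..
  have [measurable]: "\<theta> n \<in> borel_measurable M" for n
    using assms(4) by (auto simp: indep_vars_def)
  have c_summable: "summable c" and c_suminf: "suminf c = 1"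
    using assms(3) by (auto simp: sums_iff)
  have "\<exists>k. 0 < c k"
  proof (rule ccontr)
    assume "\<not> ?thesis"
    then have "c = (\<lambda>_. 0)"
      using assms(2) by (intro ext) (metis order_le_less)
    then show False
      using c_suminf by simp
  qed
  then obtain k where k: "0 < c k" ..
  have k1: "c k \<le> 1"
    using sum_le_suminf[OF c_summable, of "{k}"] assms(2) c_suminf by simp
  define C where "C = 4 / (c k)\<^sup>2"
  have C: "0 \<le> C"
    by (simp add: C_def)
  have atoms: "circle_atoms c (\<lambda>n. cis (\<theta> n \<omega>))" for \<omega>
    by standard (simp_all add: assms(2) c_summable)
  note atoms' = circle_atoms.circle_atoms_drop[OF atoms, of k]

  \<comment> \<open>The shift by two ensures \<open>1/2 \<le> r j\<close>, which the bound for a single atom requires.\<close>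
  define r where "r j = 1 - inverse (real (Suc (Suc j)))" for j
  have r: "0 < r j" "1/2 \<le> r j" "r j < 1" for j
    by (auto simp: r_def field_simps)
  have r_lim: "r \<longlonglongrightarrow> 1"
    unfolding r_def by real_asymp
  define z where "z j t = of_real (r j) * cis t" for j t
  have norm_z: "cmod (z j t) = r j" for j t
    using r[of j] by (simp add: z_def norm_mult)
  have z: "1/2 \<le> cmod (z j t)" "cmod (z j t) < 1" for j t
    using r[of j] by (simp_all add: norm_z)

  define \<phi> where "\<phi> \<omega> w = (herglotz_sum c (\<lambda>n. cis (\<theta> n \<omega>)) w - 1)
      / (herglotz_sum c (\<lambda>n. cis (\<theta> n \<omega>)) w + 1)" for \<omega> w
  define m where "m \<omega> w = min 1 (Re (herglotz_sum (c(k := 0)) (\<lambda>n. cis (\<theta> n \<omega>)) w))" for \<omega> w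
  have m: "0 \<le> m \<omega> (z j t)" "m \<omega> (z j t) \<le> 1" for \<omega> j t
    using circle_atoms.Re_herglotz_sum_nonneg[OF atoms' z(2)] by (auto simp: m_def)
  have [measurable]: "(\<lambda>p. neg_log (cmod (\<phi> (fst p) (z j (snd p))))) \<in> borel_measurable (M \<Otimes>\<^sub>M uniform_angle)"
    "(\<lambda>p. m (fst p) (z j (snd p))) \<in> borel_measurable (M \<Otimes>\<^sub>M uniform_angle)" for j
    unfolding \<phi>_def m_def z_def by measurable
  define I where "I j \<omega> = (\<integral>\<^sup>+t. neg_log (cmod (\<phi> \<omega> (z j t))) \<partial>uniform_angle)" for j \<omega>
  define A where "A j \<omega> = (\<integral>\<^sup>+t. ennreal (m \<omega> (z j t)) \<partial>uniform_angle)" for j \<omega>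
  have I_meas [measurable]: "I j \<in> borel_measurable M" for j
    unfolding I_def[abs_def] by (rule U.borel_measurable_nn_integral) (simp add: split_beta')
  have A_meas [measurable]: "A j \<in> borel_measurable M" for j
    unfolding A_def[abs_def] by (rule U.borel_measurable_nn_integral) (simp add: split_beta')
  have A_lim: "(\<lambda>j. \<integral>\<^sup>+\<omega>. A j \<omega> \<partial>M) \<longlonglongrightarrow> (\<integral>\<^sup>+\<omega>. 0 \<partial>M)"
  proof (rule nn_integral_dominated_convergence[where w = "\<lambda>_. 1"])
    show "AE \<omega> in M. A j \<omega> \<le> 1" for j
    proof (rule AE_I2)
      fix \<omega>
      have "A j \<omega> \<le> (\<integral>\<^sup>+t. 1 \<partial>uniform_angle)"
        unfolding A_def using m by (intro nn_integral_mono) simp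
      then show "A j \<omega> \<le> 1"
        by (simp add: U.emeasure_space_1 del: space_uniform_measure)
    qed
    show "AE \<omega> in M. (\<lambda>j. A j \<omega>) \<longlonglongrightarrow> 0"
      unfolding A_def m_def z_def
      by (intro AE_I2 circle_atoms.mean_min_1_Re_herglotz_sum_tendsto_0[OF atoms'] r r_lim)
  qed (simp_all add: emeasure_space_1)
  have I_le: "(\<integral>\<^sup>+\<omega>. I j \<omega> \<partial>M) \<le> ennreal (- ln (r j)) + ennreal C * (\<integral>\<^sup>+\<omega>. A j \<omega> \<partial>M)" for j
  proof -
    have "(\<integral>\<^sup>+\<omega>. I j \<omega> \<partial>M) = (\<integral>\<^sup>+t. \<integral>\<^sup>+\<omega>. neg_log (cmod (\<phi> \<omega> (z j t))) \<partial>M \<partial>uniform_angle)"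
      unfolding I_def by (rule MU.Fubini'[symmetric]) (simp add: split_beta')
    also have "\<dots> \<le> (\<integral>\<^sup>+t. \<integral>\<^sup>+\<omega>. ennreal (- ln (r j) + C * m \<omega> (z j t)) \<partial>M \<partial>uniform_angle)"
    proof (rule nn_integral_mono)
      show "(\<integral>\<^sup>+\<omega>. neg_log (cmod (\<phi> \<omega> (z j t))) \<partial>M)
          \<le> (\<integral>\<^sup>+\<omega>. ennreal (- ln (r j) + C * m \<omega> (z j t)) \<partial>M)" for t
        using expectation_neg_log_le[OF assms(1,2) c_summable k k1 assms(4,5) z[of j t]]
        unfolding \<phi>_def m_def C_def norm_z .
    qed
    also have "\<dots> = (\<integral>\<^sup>+\<omega>. \<integral>\<^sup>+t. ennreal (- ln (r j) + C * m \<omega> (z j t)) \<partial>uniform_angle \<partial>M)"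
      by (rule MU.Fubini') (simp add: split_beta')
    also have "\<dots> = (\<integral>\<^sup>+\<omega>. ennreal (- ln (r j)) + ennreal C * A j \<omega> \<partial>M)"
    proof (rule nn_integral_cong)
      fix \<omega> assume \<omega>: "\<omega> \<in> space M"
      have [measurable]: "(\<lambda>t. m \<omega> (z j t)) \<in> borel_measurable uniform_angle"
        unfolding m_def z_def by measurable
      have "ennreal (- ln (r j) + C * m \<omega> (z j t)) = ennreal (- ln (r j)) + ennreal C * ennreal (m \<omega> (z j t))" for t
      proof -
        have "0 \<le> - ln (r j)" "0 \<le> C * m \<omega> (z j t)"
          using r[of j] C m[of \<omega> j t] by simp_all
        then show ?thesis
          using C m[of \<omega> j t] by (simp only: ennreal_plus ennreal_mult)
      qed
      then show "(\<integral>\<^sup>+t. ennreal (- ln (r j) + C * m \<omega> (z j t)) \<partial>uniform_angle)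
          = ennreal (- ln (r j)) + ennreal C * A j \<omega>"
        unfolding A_def
        by (simp add: nn_integral_add nn_integral_cmult U.emeasure_space_1 del: space_uniform_measure)
    qed
    also have "\<dots> = ennreal (- ln (r j)) + ennreal C * (\<integral>\<^sup>+\<omega>. A j \<omega> \<partial>M)"
      by (simp add: nn_integral_add nn_integral_cmult emeasure_space_1)
    finally show ?thesis .
  qed
  have "(\<lambda>j. ennreal (- ln (r j)) + ennreal C * (\<integral>\<^sup>+\<omega>. A j \<omega> \<partial>M)) \<longlonglongrightarrow> ennreal (- ln 1) + ennreal C * (\<integral>\<^sup>+\<omega>. 0 \<partial>M)"
    by (intro tendsto_add tendsto_ennrealI tendsto_minus tendsto_ln r_lim ennreal_tendsto_cmult A_lim) simp_all
  then have bound_lim: "(\<lambda>j. ennreal (- ln (r j)) + ennreal C * (\<integral>\<^sup>+\<omega>. A j \<omega> \<partial>M)) \<longlonglongrightarrow> 0"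
    by simp
  have I_lim: "(\<lambda>j. \<integral>\<^sup>+\<omega>. I j \<omega> \<partial>M) \<longlonglongrightarrow> 0"
    by (rule tendsto_sandwich[OF _ _ tendsto_const bound_lim])
      (auto intro: always_eventually I_le)
  \<comment> \<open>Fatou: convergence in mean gives circle means with lower limit 0 for almost every \<open>\<omega>\<close>.\<close>
  have "(\<integral>\<^sup>+\<omega>. liminf (\<lambda>j. I j \<omega>) \<partial>M) \<le> liminf (\<lambda>j. \<integral>\<^sup>+\<omega>. I j \<omega> \<partial>M)"
    by (rule nn_integral_liminf) simp
  also have "\<dots> = 0"
    using I_lim by (rule lim_imp_Liminf[OF sequentially_bot])
  finally have "AE \<omega> in M. liminf (\<lambda>j. I j \<omega>) = 0"
    by (subst (asm) le_zero_eq, subst (asm) nn_integral_0_iff_AE) auto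
  then show ?thesis
  proof eventually_elim
    case (elim \<omega>)
    interpret circle_atoms c "\<lambda>n. cis (\<theta> n \<omega>)"
      by (rule atoms)
    have \<phi>: "associated_inner (atomic_measure c (\<lambda>n. cis (\<theta> n \<omega>))) (z j t) = \<phi> \<omega> (z j t)" for j t
      unfolding \<phi>_def by (rule associated_inner_atomic_measure[OF z(2)])
    have "is_blaschke_product (associated_inner (atomic_measure c (\<lambda>n. cis (\<theta> n \<omega>))))"
    proof (rule is_blaschke_product_if_small_log_means)
      fix \<epsilon> :: real assume "0 < \<epsilon>"
      have "\<exists>j. I j \<omega> \<le> ennreal \<epsilon>"
      proof (rule ccontr)
        assume "\<not> ?thesis"
        then have "ennreal \<epsilon> \<le> I j \<omega>" for j
          by (metis linear)
        then have "ennreal \<epsilon> \<le> liminf (\<lambda>j. I j \<omega>)"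
          by (intro Liminf_bounded always_eventually) simp
        then show False
          using elim \<open>0 < \<epsilon>\<close> by simp
      qed
      then obtain j where "I j \<omega> \<le> ennreal \<epsilon>" ..
      then show "\<exists>r. 0 < r \<and> r < 1 \<and>
          (\<integral>\<^sup>+t. neg_log (cmod (associated_inner (atomic_measure c (\<lambda>n. cis (\<theta> n \<omega>)))
            (of_real r * cis t))) \<partial>uniform_angle) \<le> ennreal \<epsilon>"
        using r[of j] by (intro exI[of _ "r j"]) (simp add: I_def \<phi>[unfolded z_def] z_def)
    qed (simp_all add: associated_inner_holomorphic norm_associated_inner_le_1)
    then show ?case
      by (simp only: cis_conv_exp)
  qed
qed

end
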